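(* Let $D\subseteq\mathbb{R}^2$ be a closed disk of unit radius, and partition $D$ into two (Lebesgue measurable) regions $A,B$ whose closures are each homeomorphic to $D$. Then \[ \max\Big\{|\partial A|,|\partial B|\Big\}\geq \pi+2, \qquad \min\bigg\{\frac{|A|}{|\operatorname{hull}(A)|},\frac{|B|}{|\operatorname{hull}(B)|}\bigg\}\leq 1, \qquad I_A+I_B\geq\frac{\pi}{2}-\frac{16}{9\pi}. \] Moreover, equality is simultaneously achieved in all three when $A$ and $B$ are complementary half-disks.
   Context: For a region $R\subseteq\mathbb{R}^2$: $|\partial R|$ denotes the length of its boundary (perimeter), $|R|$ its area (Lebesgue measure), and $\operatorname{hull}(R)$ its convex hull. For a Lebesgue measurable $R\subseteq\mathbb{R}^2$ of positive area, its centroid and moment of inertia are \[ \mu_R=\frac{1}{|R|}\iint_R x\,d\operatorname{Leb}(x), \qquad I_R=\iint_R \|x-\mu_R\|^2\,d\operatorname{Leb}(x). \] *)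

theory Defs
  imports "HOL-Analysis.Analysis"
begin

definition hausdorff1_pre :: "real \<Rightarrow> 'a::metric_space set \<Rightarrow> ennreal" where
  "hausdorff1_pre \<delta> S =
     (INF U \<in> {U :: nat \<Rightarrow> 'a set. S \<subseteq> (\<Union>i. U i) \<and> (\<forall>i. bounded (U i) \<and> diameter (U i) \<le> \<delta>)}.
        (\<Sum>i. ennreal (diameter (U i))))"

text \<open>One-dimensional Hausdorff measure, normalised so that it is arc length on rectifiable arcs.\<close>

definition hausdorff1 :: "'a::metric_space set \<Rightarrow> ennreal" where
  "hausdorff1 S = (SUP \<delta> \<in> {0<..}. hausdorff1_pre \<delta> S)"

text \<open>The boundary length may be infinite, hence the extended nonnegative values.\<close>

definition perimeter :: "(real^2) set \<Rightarrow> ennreal" where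
  "perimeter R = hausdorff1 (frontier R)"

definition area :: "(real^2) set \<Rightarrow> real" where
  "area R = measure lebesgue R"

definition centroid :: "(real^2) set \<Rightarrow> real^2" where
  "centroid R = (1 / area R) *\<^sub>R (LINT x:R|lebesgue. x)"

definition moment_of_inertia :: "(real^2) set \<Rightarrow> real" where
  "moment_of_inertia R = (LINT x:R|lebesgue. (norm (x - centroid R))\<^sup>2)"

definition disk_partition :: "(real^2) set \<Rightarrow> (real^2) set \<Rightarrow> (real^2) set \<Rightarrow> bool" where
  "disk_partition D A B \<longleftrightarrow>
     A \<union> B = D \<and> A \<inter> B = {} \<and>
     A \<in> sets lebesgue \<and> B \<in> sets lebesgue \<and>
     closure A homeomorphic D \<and> closure B homeomorphic D"

text \<open>The points of the common diameter may be shared out between the two halves arbitrarily.\<close>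

definition complementary_half_disks :: "real^2 \<Rightarrow> (real^2) set \<Rightarrow> (real^2) set \<Rightarrow> bool" where
  "complementary_half_disks c A B \<longleftrightarrow>
     A \<union> B = cball c 1 \<and> A \<inter> B = {} \<and>
     (\<exists>v. v \<noteq> 0 \<and>
        {x \<in> cball c 1. v \<bullet> (x - c) > 0} \<subseteq> A \<and>
        {x \<in> cball c 1. v \<bullet> (x - c) < 0} \<subseteq> B)"

end

theory Submission
  imports Defs
begin

text \<open>
  Perimeter. Let \<open>K\<close> and \<open>L\<close> be the closures of \<open>A\<close> and \<open>B\<close>, and \<open>S\<close> the unit circle. The boundary of
  \<open>A\<close> contains \<open>K \<inter> S\<close> and \<open>K \<inter> L\<close>, and symmetrically for \<open>B\<close>. By invariance of domain \<open>K\<close> and \<open>L\<close>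
  are the closures of connected open subsets \<open>V\<close> and \<open>W\<close> of the open disk. If \<open>V\<close> and \<open>W\<close> meet, then
  \<open>K \<inter> L\<close> has interior points and both perimeters are infinite. Otherwise two pairs of points of \<open>S\<close>
  joined through \<open>V\<close> and through \<open>W\<close> cannot interlace (Fashoda's theorem after an inversion), so
  \<open>K \<inter> S\<close> is an arc of some length \<open>\<tau>\<close>, with end points \<open>p\<close> and \<open>q\<close> in \<open>K \<inter> L\<close>. Each chord perpendicular
  to \<open>q - p\<close> strictly between \<open>p\<close> and \<open>q\<close> meets \<open>V\<close> and \<open>W\<close>, hence \<open>K \<inter> L\<close>, inside the open disk.
  Projecting, the part of \<open>K \<inter> L\<close> off \<open>S\<close> has length at least \<open>\<bar>p - q\<bar> = 2 sin (\<tau> / 2)\<close>. The longer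
  of the arcs \<open>\<tau>\<close> and \<open>2 \<pi> - \<tau>\<close> then gives a perimeter of at least \<open>\<pi> + 2\<close>, because
  \<open>\<tau> + 2 sin (\<tau> / 2)\<close> is nondecreasing.

  Moment of inertia. Let \<open>m\<close> be the first moment of \<open>A\<close> about the centre and \<open>a\<close>, \<open>b\<close> the two areas.
  The sum of the moments of inertia is \<open>\<pi> / 2 - \<bar>m\<bar>\<^sup>2 (1 / a + 1 / b)\<close>, and \<open>\<bar>m\<bar>\<close> is at most the first
  moment \<open>2 / 3 cos\<^sup>3 t\<close> of the circular cap of area \<open>a = \<pi> / 2 - t - sin t cos t\<close>. What remains is the
  inequality \<open>4 (t + sin t cos t)\<^sup>2 \<le> \<pi>\<^sup>2 (1 - cos\<^sup>6 t)\<close>.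
\<close>

section \<open>One-dimensional Hausdorff measure\<close>

lemma hausdorff1_pre_antimono:
  assumes "\<delta> \<le> \<delta>'" "S \<subseteq> T"
  shows "hausdorff1_pre \<delta>' S \<le> hausdorff1_pre \<delta> T"
  unfolding hausdorff1_pre_def using assms
  by (intro INF_superset_mono) (auto intro: order_trans)

lemma hausdorff1_mono: "S \<subseteq> T \<Longrightarrow> hausdorff1 S \<le> hausdorff1 T"
  unfolding hausdorff1_def by (intro SUP_mono) (auto intro: hausdorff1_pre_antimono)

lemma hausdorff1_pre_le: "\<delta> > 0 \<Longrightarrow> hausdorff1_pre \<delta> S \<le> hausdorff1 S"
  unfolding hausdorff1_def by (intro SUP_upper) auto

text \<open>The image of a cover member need not be measurable, so it is enclosed in the interval
  from its infimum to its supremum.\<close>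

lemma emeasure_le_of_pairwise_abs_diff_le:
  fixes X :: "real set"
  assumes "\<And>x y. x \<in> X \<Longrightarrow> y \<in> X \<Longrightarrow> \<bar>x - y\<bar> \<le> d" "0 \<le> d"
  shows "\<exists>I \<in> sets borel. X \<subseteq> I \<and> emeasure lborel I \<le> ennreal d"
proof (cases "X = {}")
  case False
  then obtain x0 where x0: "x0 \<in> X" by auto
  have below: "x0 - d \<le> x \<and> x \<le> x0 + d" if "x \<in> X" for x
    using assms(1)[OF that x0] by (auto simp: abs_le_iff)
  have bdd: "bdd_above X" "bdd_below X"
    using below by (auto intro!: bdd_aboveI[of _ "x0 + d"] bdd_belowI[of _ "x0 - d"])
  have "x \<le> Inf X + d" if "x \<in> X" for x
  proof -
    have "x - d \<le> Inf X"
      using False assms(1)[OF that] by (intro cInf_greatest) (force simp: abs_le_iff)+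
    then show ?thesis by simp
  qed
  then have "Sup X \<le> Inf X + d"
    using False by (intro cSup_least)
  moreover have "Inf X \<le> Sup X"
    using bdd x0 by (meson cInf_lower cSup_upper order_trans)
  ultimately have "emeasure lborel {Inf X..Sup X} \<le> ennreal d"
    by (simp add: ennreal_leI)
  moreover have "X \<subseteq> {Inf X..Sup X}"
    using bdd by (auto intro: cInf_lower cSup_upper)
  ultimately show ?thesis by (intro bexI[of _ "{Inf X..Sup X}"]) auto
qed (auto intro!: bexI[of _ "{}"])

text \<open>Every cover of \<open>S\<close> by sets of diameter at most \<open>\<delta>\<close> is
  carried by \<open>f\<close> to a cover of \<open>E\<close> by intervals, longer by at most the
  factor \<open>C\<close>. Points of one cover member are within \<open>\<delta>\<close> of each
  other, so a Lipschitz bound at that scale is enough.\<close>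

lemma emeasure_image_le_hausdorff1_pre:
  fixes f :: "'a::metric_space \<Rightarrow> real"
  assumes lip: "\<And>x y. x \<in> S \<Longrightarrow> y \<in> S \<Longrightarrow> dist x y \<le> \<delta> \<Longrightarrow> \<bar>f x - f y\<bar> \<le> C * dist x y"
    and "C > 0" "E \<subseteq> f ` S"
  shows "emeasure lborel E \<le> ennreal C * hausdorff1_pre \<delta> S"
proof -
  \<comment> \<open>Dividing by \<open>C\<close> leaves the plain sum of diameters on the right, so
    that the infimum over all covers can be taken there.\<close>
  have "emeasure lborel E / ennreal C \<le> (\<Sum>i. ennreal (diameter (U i)))"
    if U: "S \<subseteq> (\<Union>i. U i)" "\<And>i. bounded (U i)" "\<And>i. diameter (U i) \<le> \<delta>" for U :: "nat \<Rightarrow> 'a set"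
  proof -
    have "\<exists>I \<in> sets borel. f ` (U i \<inter> S) \<subseteq> I \<and> emeasure lborel I \<le> ennreal (C * diameter (U i))" for i
    proof (rule emeasure_le_of_pairwise_abs_diff_le)
      show "0 \<le> C * diameter (U i)" using U(2) \<open>C > 0\<close> by (simp add: diameter_ge_0)
      fix x y assume "x \<in> f ` (U i \<inter> S)" "y \<in> f ` (U i \<inter> S)"
      then obtain a b where ab: "a \<in> U i" "a \<in> S" "b \<in> U i" "b \<in> S" "x = f a" "y = f b" by auto
      have d: "dist a b \<le> diameter (U i)" using ab U(2) by (intro diameter_bounded_bound) auto
      then have "\<bar>x - y\<bar> \<le> C * dist a b" using lip ab U(3)[of i] by auto
      also have "\<dots> \<le> C * diameter (U i)" using d \<open>C > 0\<close> by simp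
      finally show "\<bar>x - y\<bar> \<le> C * diameter (U i)" .
    qed
    then obtain I where I: "\<And>i. I i \<in> sets borel" "\<And>i. f ` (U i \<inter> S) \<subseteq> I i"
      "\<And>i. emeasure lborel (I i) \<le> ennreal (C * diameter (U i))" by metis
    have "E \<subseteq> (\<Union>i. I i)"
    proof
      fix e assume "e \<in> E"
      then obtain x where x: "x \<in> S" "e = f x" using \<open>E \<subseteq> f ` S\<close> by auto
      then obtain i where "x \<in> U i" using U(1) by auto
      then have "e \<in> I i" using x I(2)[of i] by auto
      then show "e \<in> (\<Union>i. I i)" by auto
    qed
    then have "emeasure lborel E \<le> emeasure lborel (\<Union>i. I i)"
      using I(1) by (intro emeasure_mono) auto
    also have "\<dots> \<le> (\<Sum>i. emeasure lborel (I i))"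
      using I(1) by (intro emeasure_subadditive_countably) auto
    also have "\<dots> \<le> (\<Sum>i. ennreal (C * diameter (U i)))"
      by (intro suminf_le I) auto
    also have "\<dots> = ennreal C * (\<Sum>i. ennreal (diameter (U i)))"
      using \<open>C > 0\<close> U(2) by (simp add: ennreal_mult diameter_ge_0)
    finally show ?thesis
      using \<open>C > 0\<close> by (intro divide_le_posI_ennreal) (auto simp: mult.commute)
  qed
  then have "emeasure lborel E / ennreal C \<le> hausdorff1_pre \<delta> S"
    unfolding hausdorff1_pre_def by (intro INF_greatest) auto
  then have "ennreal C * (emeasure lborel E / ennreal C) \<le> ennreal C * hausdorff1_pre \<delta> S"
    by (intro mult_left_mono) auto
  moreover have "ennreal C * (emeasure lborel E / ennreal C) = emeasure lborel E"
    using \<open>C > 0\<close> ennreal_mult_divide_eq[of "ennreal C" "emeasure lborel E"]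
    by (simp add: ennreal_times_divide mult.commute)
  ultimately show ?thesis by simp
qed

text \<open>The angle as a function on a circle has a Lipschitz constant for the chord distance that
  is only close to 1, and only at small scales. Here the constant may tend to 1 along with the
  scale.\<close>

lemma emeasure_image_le_hausdorff1:
  fixes f :: "'a::metric_space \<Rightarrow> real"
  assumes lip: "\<And>\<epsilon>. \<epsilon> > 0 \<Longrightarrow> \<exists>\<delta>>0. \<forall>x\<in>S. \<forall>y\<in>S. dist x y \<le> \<delta> \<longrightarrow> \<bar>f x - f y\<bar> \<le> (1 + \<epsilon>) * dist x y"
    and E: "E \<subseteq> f ` S"
  shows "emeasure lborel E \<le> hausdorff1 S"
proof (cases "hausdorff1 S" rule: ennreal_cases)
  case (real r)
  have le: "emeasure lborel E \<le> ennreal ((1 + \<epsilon>) * r)" if \<epsilon>: "\<epsilon> > 0" for \<epsilon>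
  proof -
    obtain \<delta> where "\<delta> > 0" "\<And>x y. x \<in> S \<Longrightarrow> y \<in> S \<Longrightarrow> dist x y \<le> \<delta> \<Longrightarrow> \<bar>f x - f y\<bar> \<le> (1 + \<epsilon>) * dist x y"
      using lip[OF \<epsilon>] by blast
    then have "emeasure lborel E \<le> ennreal (1 + \<epsilon>) * hausdorff1_pre \<delta> S"
      using that E by (intro emeasure_image_le_hausdorff1_pre[where f = f]) auto
    also have "\<dots> \<le> ennreal (1 + \<epsilon>) * hausdorff1 S"
      using \<open>\<delta> > 0\<close> by (intro mult_left_mono hausdorff1_pre_le) auto
    also have "\<dots> = ennreal ((1 + \<epsilon>) * r)"
      using that real by (simp add: ennreal_mult)
    finally show ?thesis .
  qed
  have "((\<lambda>\<epsilon>. ennreal ((1 + \<epsilon>) * r)) \<longlongrightarrow> ennreal ((1 + 0) * r)) (at_right 0)"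
    by (intro tendsto_ennrealI tendsto_intros)
  then have "emeasure lborel E \<le> ennreal ((1 + 0) * r)"
    by (rule tendsto_lowerbound) (auto simp: eventually_at_right_less intro!: eventually_mono[OF eventually_at_right_less] le)
  then show ?thesis using real by simp
qed auto

text \<open>A set of diameter below \<open>d\<close> cannot meet both \<open>S\<close> and
  \<open>T\<close>, so at scales below \<open>d\<close> every cover of the union splits into a cover
  of \<open>S\<close> and a cover of \<open>T\<close>.\<close>

lemma hausdorff1_Un_ge:
  assumes "d > 0" and sep: "\<And>x y. x \<in> S \<Longrightarrow> y \<in> T \<Longrightarrow> d \<le> dist x y"
  shows "hausdorff1 S + hausdorff1 T \<le> hausdorff1 (S \<union> T)"
proof -
  have pre: "hausdorff1_pre \<delta> S + hausdorff1_pre \<delta> T \<le> hausdorff1_pre \<delta> (S \<union> T)" if "\<delta> < d" for \<delta>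
  proof -
    have "hausdorff1_pre \<delta> S + hausdorff1_pre \<delta> T \<le> (\<Sum>i. ennreal (diameter (U i)))"
      if U: "S \<union> T \<subseteq> (\<Union>i. U i)" "\<And>i. bounded (U i)" "\<And>i. diameter (U i) \<le> \<delta>" for U :: "nat \<Rightarrow> 'a set"
    proof -
      \<comment> \<open>Members that miss \<open>R\<close> are replaced by the empty set, of
        diameter 0, which keeps the cover indexed by \<open>nat\<close>.\<close>
      define V where "V = (\<lambda>R i. if U i \<inter> R = {} then {} else U i)"
      have \<delta>0: "0 \<le> \<delta>" using diameter_ge_0[OF U(2)] U(3) order_trans by blast
      have le: "hausdorff1_pre \<delta> R \<le> (\<Sum>i. ennreal (diameter (V R i)))" if R: "R \<subseteq> S \<union> T" for R
      proof -
        have "R \<subseteq> (\<Union>i. V R i)"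
        proof
          fix x assume "x \<in> R"
          then obtain i where "x \<in> U i" using U(1) R by blast
          then have "x \<in> V R i" using \<open>x \<in> R\<close> by (auto simp: V_def)
          then show "x \<in> (\<Union>i. V R i)" by blast
        qed
        then show ?thesis
          unfolding hausdorff1_pre_def using U \<delta>0
          by (intro INF_lower) (auto simp: V_def)
      qed
      have disj: "U i \<inter> S = {} \<or> U i \<inter> T = {}" for i
      proof (rule ccontr)
        assume "\<not> ?thesis"
        then obtain x y where xy: "x \<in> U i" "x \<in> S" "y \<in> U i" "y \<in> T" by blast
        have "dist x y \<le> diameter (U i)" using xy U(2) by (intro diameter_bounded_bound) auto
        then show False using sep xy U(3)[of i] \<open>\<delta> < d\<close> by fastforce
      qed
      have "hausdorff1_pre \<delta> S + hausdorff1_pre \<delta> T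
          \<le> (\<Sum>i. ennreal (diameter (V S i))) + (\<Sum>i. ennreal (diameter (V T i)))"
        by (intro add_mono le) auto
      also have "\<dots> = (\<Sum>i. ennreal (diameter (V S i)) + ennreal (diameter (V T i)))"
        by (intro suminf_add) auto
      also have "\<dots> \<le> (\<Sum>i. ennreal (diameter (U i)))"
        using disj by (intro suminf_le) (auto simp: V_def)
      finally show ?thesis .
    qed
    then show ?thesis
      unfolding hausdorff1_pre_def[of \<delta> "S \<union> T"] by (intro INF_greatest) auto
  qed
  have "hausdorff1_pre \<alpha> S + hausdorff1_pre \<beta> T \<le> hausdorff1 (S \<union> T)" if "\<alpha> > 0" "\<beta> > 0" for \<alpha> \<beta>
  proof -
    \<comment> \<open>The two suprema run over independent scales; a common scale finer than both
      and below \<open>d\<close> bounds their sum.\<close>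
    define \<delta> where "\<delta> = min (min \<alpha> \<beta>) (d / 2)"
    have \<delta>: "0 < \<delta>" "\<delta> < d" "\<delta> \<le> \<alpha>" "\<delta> \<le> \<beta>" using that \<open>d > 0\<close> by (auto simp: \<delta>_def)
    have "hausdorff1_pre \<alpha> S + hausdorff1_pre \<beta> T \<le> hausdorff1_pre \<delta> S + hausdorff1_pre \<delta> T"
      using \<delta> by (intro add_mono hausdorff1_pre_antimono) auto
    also have "\<dots> \<le> hausdorff1 (S \<union> T)"
      using pre[OF \<delta>(2)] hausdorff1_pre_le[OF \<delta>(1)] order_trans by blast
    finally show ?thesis .
  qed
  then have "hausdorff1_pre \<alpha> S + hausdorff1 T \<le> hausdorff1 (S \<union> T)" if "\<alpha> > 0" for \<alpha>
    using that unfolding hausdorff1_def[of T]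
    by (subst ennreal_SUP_add_right) (auto intro!: SUP_least)
  then show ?thesis
    unfolding hausdorff1_def[of S]
    by (subst ennreal_SUP_add_left[symmetric]) (auto intro!: SUP_least)
qed

corollary hausdorff1_Un_compact_ge:
  fixes S T :: "'a::heine_borel set"
  assumes "compact S" "compact T" "S \<inter> T = {}"
  shows "hausdorff1 S + hausdorff1 T \<le> hausdorff1 (S \<union> T)"
proof -
  obtain d where "d > 0" "\<And>x y. x \<in> S \<Longrightarrow> y \<in> T \<Longrightarrow> d \<le> dist x y"
    using separate_compact_closed[of S T] assms compact_imp_closed by blast
  then show ?thesis by (rule hausdorff1_Un_ge)
qed

text \<open>Cutting \<open>{0..l}\<close> into \<open>n\<close> equal pieces no longer than
  \<open>\<delta>\<close> gives a cover of the curve whose diameters add up to at most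
  \<open>l\<close>.\<close>

lemma hausdorff1_lipschitz_curve_le:
  fixes f :: "real \<Rightarrow> 'a::metric_space"
  assumes "0 \<le> l" and lip: "\<And>s t. 0 \<le> s \<Longrightarrow> s \<le> t \<Longrightarrow> t \<le> l \<Longrightarrow> dist (f s) (f t) \<le> t - s"
  shows "hausdorff1 (f ` {0..l}) \<le> ennreal l"
  unfolding hausdorff1_def
proof (rule SUP_least)
  fix \<delta> :: real assume "\<delta> \<in> {0<..}"
  then have "\<delta> > 0" by simp
  obtain n :: nat where n: "l / \<delta> < real n" using reals_Archimedean2 by blast
  have "0 \<le> l / \<delta>" using assms(1) \<open>\<delta> > 0\<close> by simp
  then have n0: "n > 0" using n by (cases n) auto
  define h where "h = l / n"
  have h: "0 \<le> h" "h \<le> \<delta>" "real n * h = l"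
    using n n0 \<open>\<delta> > 0\<close> assms(1) by (auto simp: h_def field_simps)
  define U where "U = (\<lambda>i. if i < n then f ` {real i * h..real (Suc i) * h} else {})"
  have dist_U: "dist x y \<le> h" if xy: "x \<in> U i" "y \<in> U i" for x y i
  proof -
    have i: "i < n" using that by (auto simp: U_def split: if_splits)
    have "real (Suc i) * h \<le> real n * h" using i h by (intro mult_right_mono) auto
    then have il: "real (Suc i) * h \<le> l" using h by simp
    obtain s t where st: "x = f s" "y = f t" "s \<in> {real i * h..real (Suc i) * h}" "t \<in> {real i * h..real (Suc i) * h}"
      using xy i by (auto simp: U_def)
    have ih: "0 \<le> real i * h" using h by simp
    have "s \<le> l" "t \<le> l" "\<bar>s - t\<bar> \<le> h"
      using st il by (auto simp: algebra_simps abs_le_iff)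
    moreover have "0 \<le> s" "0 \<le> t"
      using st order_trans[OF ih] by auto
    ultimately show ?thesis
      using lip[of s t] lip[of t s] st by (cases "s \<le> t") (auto simp: dist_commute)
  qed
  have bdd: "bounded (U i)" for i
    using dist_U by (meson bounded_two_points)
  have dia: "diameter (U i) \<le> h" for i
    using dist_U h by (auto simp: diameter_def intro!: cSUP_least)
  have "f ` {0..l} \<subseteq> (\<Union>i. U i)"
  proof
    fix x assume "x \<in> f ` {0..l}"
    then obtain t where t: "x = f t" "0 \<le> t" "t \<le> l" by auto
    show "x \<in> (\<Union>i. U i)"
    \<comment> \<open>The floor of \<open>l / h\<close> is \<open>n\<close>, one past the last
      piece, so the right end point is put into piece \<open>n - 1\<close>. This case also absorbs
      \<open>l = 0\<close>, where \<open>h = 0\<close>.\<close>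
    proof (cases "t = l")
      case True
      have "x \<in> U (n - 1)"
        using n0 True t h by (auto simp: U_def algebra_simps of_nat_diff intro!: imageI)
      then show ?thesis by blast
    next
      case False
      then have hp: "h > 0" using t n0 assms(1) by (auto simp: h_def)
      define i where "i = nat \<lfloor>t / h\<rfloor>"
      have r: "real i = of_int \<lfloor>t / h\<rfloor>" using t hp by (simp add: i_def)
      have "real i \<le> t / h" "t / h < real i + 1" unfolding r by linarith+
      then have b: "real i * h \<le> t" "t < real (Suc i) * h" using hp by (auto simp: field_simps)
      have "real i * h < real n * h" using b t h False by linarith
      then have "i < n" using hp by simp
      then have "x \<in> U i" using b t by (auto simp: U_def intro!: imageI)
      then show ?thesis by blast
    qed
  qed
  then have "hausdorff1_pre \<delta> (f ` {0..l}) \<le> (\<Sum>i. ennreal (diameter (U i)))"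
    unfolding hausdorff1_pre_def using bdd order_trans[OF dia h(2)] by (intro INF_lower) auto
  also have "\<dots> = (\<Sum>i<n. ennreal (diameter (U i)))"
    by (intro suminf_finite) (auto simp: U_def)
  also have "\<dots> \<le> (\<Sum>i<n. ennreal h)"
    using dia by (intro sum_mono ennreal_leI) auto
  also have "\<dots> = ennreal l"
    using h by (simp add: ennreal_of_nat_eq_real_of_nat ennreal_mult[symmetric])
  finally show "hausdorff1_pre \<delta> (f ` {0..l}) \<le> ennreal l" .
qed

section \<open>Arcs of the unit circle\<close>

text \<open>A ball contains any number of disjoint parallel segments of one fixed length, so the
  measure is at least every multiple of that length.\<close>

lemma hausdorff1_eq_top_of_interior:
  fixes X :: "(real^2) set"
  assumes "interior X \<noteq> {}"
  shows "hausdorff1 X = top"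
proof -
  obtain x where "x \<in> interior X" using assms by blast
  then obtain e where e: "e > 0" "ball x e \<subseteq> X" by (auto simp: mem_interior)
  define g where "g = (\<lambda>a y. x + a *\<^sub>R axis 1 1 + y *\<^sub>R axis 2 1 :: real^2)"
  define Seg where "Seg = (\<lambda>y. (\<lambda>a. g a y) ` {0..e/2})"
  have g1: "g a y $ 1 = x $ 1 + a" and g2: "g a y $ 2 = x $ 2 + y" for a y
    by (auto simp: g_def axis_def)
  have cpt: "compact (Seg y)" for y
    unfolding Seg_def g_def by (intro compact_continuous_image continuous_intros) auto
  have len: "ennreal (e/2) \<le> hausdorff1 (Seg y)" for y
  proof -
    have "emeasure lborel {x $ 1..x $ 1 + e/2} \<le> hausdorff1 (Seg y)"
    proof (rule emeasure_image_le_hausdorff1[where f = "\<lambda>z. z $ 1"])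
      fix \<epsilon> :: real assume "\<epsilon> > 0"
      have "\<bar>z $ 1 - z' $ 1\<bar> \<le> (1 + \<epsilon>) * dist z z'" for z z' :: "real^2"
      proof -
        have "\<bar>z $ 1 - z' $ 1\<bar> \<le> dist z z'"
          using component_le_norm_cart[of "z - z'" 1] by (simp add: dist_norm)
        also have "\<dots> \<le> (1 + \<epsilon>) * dist z z'"
          using \<open>\<epsilon> > 0\<close> mult_right_mono[of 1 "1 + \<epsilon>" "dist z z'"] by simp
        finally show ?thesis .
      qed
      then show "\<exists>\<delta>>0. \<forall>z\<in>Seg y. \<forall>z'\<in>Seg y. dist z z' \<le> \<delta> \<longrightarrow> \<bar>z $ 1 - z' $ 1\<bar> \<le> (1 + \<epsilon>) * dist z z'"
        by (intro exI[of _ 1]) auto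
    next
      show "{x $ 1..x $ 1 + e/2} \<subseteq> (\<lambda>z. z $ 1) ` Seg y"
      proof
        fix s assume "s \<in> {x $ 1..x $ 1 + e/2}"
        then show "s \<in> (\<lambda>z. z $ 1) ` Seg y"
          by (intro image_eqI[of _ _ "g (s - x $ 1) y"]) (auto simp: Seg_def g1)
      qed
    qed
    then show ?thesis using e by simp
  qed
  have lower: "ennreal (real n * (e/2)) \<le> hausdorff1 X" for n
  proof -
    \<comment> \<open>These heights stay below \<open>e / 2\<close> and the segments have length
      \<open>e / 2\<close>, so by the triangle inequality all of them lie in the ball of radius
      \<open>e\<close>.\<close>
    define y where "y = (\<lambda>i. real i * (e / (2 * real n)))"
    have sum: "ennreal (real k * (e/2)) \<le> hausdorff1 (\<Union>i<k. Seg (y i))" if "k \<le> n" for k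
      using that
    proof (induction k)
      case (Suc k)
      have n: "n > 0" using Suc by simp
      have "(\<Union>i<k. Seg (y i)) \<inter> Seg (y k) = {}"
      proof (rule ccontr)
        assume "(\<Union>i<k. Seg (y i)) \<inter> Seg (y k) \<noteq> {}"
        then obtain i a b where i: "i < k" "g a (y k) = g b (y i)" by (auto simp: Seg_def)
        then have "y i = y k" by (metis g2 add_left_cancel)
        then show False using i n e by (auto simp: y_def)
      qed
      then have disj: "hausdorff1 (\<Union>i<k. Seg (y i)) + hausdorff1 (Seg (y k))
          \<le> hausdorff1 ((\<Union>i<k. Seg (y i)) \<union> Seg (y k))"
        using cpt by (intro hausdorff1_Un_compact_ge compact_UN) auto
      have "real (Suc k) * (e/2) = real k * (e/2) + e/2" by (simp add: algebra_simps)
      then have "ennreal (real (Suc k) * (e/2)) = ennreal (real k * (e/2) + e/2)" by (simp only:)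
      also have "\<dots> = ennreal (real k * (e/2)) + ennreal (e/2)"
        using e by (intro ennreal_plus) auto
      also have "\<dots> \<le> hausdorff1 (\<Union>i<k. Seg (y i)) + hausdorff1 (Seg (y k))"
        using Suc by (intro add_mono len) auto
      also note disj
      also have "(\<Union>i<k. Seg (y i)) \<union> Seg (y k) = (\<Union>i<Suc k. Seg (y i))"
        by (auto simp: less_Suc_eq)
      finally show ?case .
    qed simp
    have "Seg (y i) \<subseteq> ball x e" if "i < n" for i
    proof
      fix z assume "z \<in> Seg (y i)"
      then obtain a where a: "0 \<le> a" "a \<le> e/2" "z = g a (y i)" by (auto simp: Seg_def)
      have yi: "0 \<le> y i" "y i < e/2"
        using that e by (auto simp: y_def field_simps)
      have "norm (z - x) = norm (a *\<^sub>R axis 1 1 + y i *\<^sub>R axis 2 1 :: real^2)"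
        by (simp add: a g_def)
      also have "\<dots> \<le> norm (a *\<^sub>R axis 1 1 :: real^2) + norm (y i *\<^sub>R axis 2 1 :: real^2)"
        by (rule norm_triangle_ineq)
      also have "\<dots> = a + y i"
        using a yi by (simp add: norm_axis_1)
      finally show "z \<in> ball x e"
        using a yi by (simp add: dist_norm norm_minus_commute)
    qed
    then have "(\<Union>i<n. Seg (y i)) \<subseteq> X" using e by blast
    then show ?thesis using sum[of n] hausdorff1_mono order_trans by blast
  qed
  show ?thesis
  proof (cases "hausdorff1 X" rule: ennreal_cases)
    case (real r)
    obtain n :: nat where "r / (e/2) < real n" using reals_Archimedean2 by blast
    then have "r < real n * (e/2)" using e by (simp add: field_simps)
    then show ?thesis using lower[of n] real by (simp add: ennreal_le_iff)
  qed
qed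

section \<open>Angular parametrisation of the unit circle and the length of its arcs\<close>

definition circle_pt :: "real^2 \<Rightarrow> real \<Rightarrow> real^2" where
  "circle_pt c t = c + cos t *\<^sub>R axis 1 1 + sin t *\<^sub>R axis 2 1"

lemma circle_pt_nth [simp]: "circle_pt c t $ 1 = c $ 1 + cos t" "circle_pt c t $ 2 = c $ 2 + sin t"
  by (auto simp: circle_pt_def axis_def)

lemma norm_vec2_sq: "(norm x)\<^sup>2 = (x $ 1)\<^sup>2 + (x $ 2)\<^sup>2" for x :: "real^2"
  unfolding power2_norm_eq_inner by (simp add: inner_vec_def sum_2 power2_eq_square)

lemma continuous_circle_pt [continuous_intros]:
  fixes f :: "real \<Rightarrow> real"
  shows "continuous_on T f \<Longrightarrow> continuous_on T (\<lambda>t. circle_pt c (f t))"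
  unfolding circle_pt_def by (intro continuous_intros)

lemma dist_circle_pt: "dist (circle_pt c s) (circle_pt c t) = 2 * \<bar>sin ((s - t) / 2)\<bar>"
proof -
  have "(dist (circle_pt c s) (circle_pt c t))\<^sup>2 = (cos s - cos t)\<^sup>2 + (sin s - sin t)\<^sup>2"
    by (simp add: dist_norm norm_vec2_sq)
  also have "\<dots> = 2 - 2 * cos (s - t)"
    using sin_cos_squared_add[of s] sin_cos_squared_add[of t]
    by (simp add: cos_diff power2_eq_square algebra_simps)
  also have "\<dots> = (2 * \<bar>sin ((s - t) / 2)\<bar>)\<^sup>2"
  proof -
    have "s - t = 2 * ((s - t) / 2)" by (simp add: field_simps)
    then have "cos (s - t) = cos (2 * ((s - t) / 2))" by (rule arg_cong)
    also have "\<dots> = 1 - 2 * (sin ((s - t) / 2))\<^sup>2" by (rule cos_double_sin)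
    finally show ?thesis by (simp add: power_mult_distrib)
  qed
  finally show ?thesis by (rule power2_eq_imp_eq) auto
qed

lemma circle_pt_in_sphere [simp]: "circle_pt c t \<in> sphere c 1"
proof -
  have "(dist c (circle_pt c t))\<^sup>2 = 1\<^sup>2"
    by (simp add: dist_norm norm_vec2_sq)
  then have "dist c (circle_pt c t) = 1" by (rule power2_eq_imp_eq) auto
  then show ?thesis by simp
qed

text \<open>The offset \<open>\<theta>\<close> allows angles to be measured from any chosen point of
  the circle.\<close>

lemma circle_pt_surj:
  assumes "x \<in> sphere c 1"
  obtains t where "0 \<le> t" "t < 2 * pi" "x = circle_pt c (\<theta> + t)"
proof -
  define a b where "a = (x - c) $ 1" and "b = (x - c) $ 2"
  have ab: "a\<^sup>2 + b\<^sup>2 = 1"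
    using assms norm_vec2_sq[of "x - c"] by (simp add: a_def b_def dist_norm norm_minus_commute)
  \<comment> \<open>The vector \<open>(a, b)\<close> turned by the angle \<open>- \<theta>\<close>
    is again a unit vector; its polar angle is the required \<open>t\<close>.\<close>
  have "(a * cos \<theta> + b * sin \<theta>)\<^sup>2 + (b * cos \<theta> - a * sin \<theta>)\<^sup>2 = (a\<^sup>2 + b\<^sup>2) * ((sin \<theta>)\<^sup>2 + (cos \<theta>)\<^sup>2)"
    by algebra
  then have "(a * cos \<theta> + b * sin \<theta>)\<^sup>2 + (b * cos \<theta> - a * sin \<theta>)\<^sup>2 = 1" using ab by simp
  then obtain t where t: "0 \<le> t" "t < 2 * pi" "a * cos \<theta> + b * sin \<theta> = cos t" "b * cos \<theta> - a * sin \<theta> = sin t"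
    using sincos_total_2pi by metis
  have "cos (\<theta> + t) = a * ((sin \<theta>)\<^sup>2 + (cos \<theta>)\<^sup>2)" "sin (\<theta> + t) = b * ((sin \<theta>)\<^sup>2 + (cos \<theta>)\<^sup>2)"
    unfolding cos_add sin_add t(3,4)[symmetric] by algebra+
  then have "x = circle_pt c (\<theta> + t)"
    by (auto simp: vec_eq_iff forall_2 a_def b_def)
  then show ?thesis using that t by blast
qed

lemma circle_pt_inj:
  assumes "circle_pt c s = circle_pt c t" "\<bar>s - t\<bar> < 2 * pi"
  shows "s = t"
proof -
  have "sin ((s - t) / 2) = 0" using assms(1) dist_circle_pt[of c s t] by simp
  then show ?thesis using assms(2) sin_eq_0_pi[of "(s - t) / 2"] by auto
qed

text \<open>The map from the arc back to the angle stretches chord distances by a factor close to 1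
  at small scales, because \<open>sin x / x\<close> tends to 1, and its image is the interval of
  angles.\<close>

lemma hausdorff1_arc_ge:
  assumes "t2 - t1 < 2 * pi"
  shows "ennreal (t2 - t1) \<le> hausdorff1 (circle_pt c ` {t1..t2})"
proof (cases "t1 < t2")
  case True
  define \<tau> where "\<tau> = t2 - t1"
  define f where "f = inv_into {t1..t2} (circle_pt c)"
  have inj: "inj_on (circle_pt c) {t1..t2}"
    using assms by (intro inj_onI circle_pt_inj) auto
  have f: "f (circle_pt c t) = t" if "t \<in> {t1..t2}" for t
    unfolding f_def using inj that by (rule inv_into_f_f)
  have "emeasure lborel {t1..t2} \<le> hausdorff1 (circle_pt c ` {t1..t2})"
  proof (rule emeasure_image_le_hausdorff1[where f = f])
    fix \<epsilon> :: real assume "\<epsilon> > 0"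
    have "((\<lambda>x::real. sin x / x) \<longlongrightarrow> 1) (at 0)"
      using DERIV_sin[of "0::real"] by (simp add: has_field_derivative_iff)
    from tendsto_mult_left[OF this, of "1 + \<epsilon>"]
    have "((\<lambda>x::real. (1 + \<epsilon>) * (sin x / x)) \<longlongrightarrow> (1 + \<epsilon>) * 1) (at_right 0)"
      by (rule tendsto_within_subset) simp
    then have "\<forall>\<^sub>F x in at_right 0. 1 < (1 + \<epsilon>) * (sin x / x)"
      using \<open>\<epsilon> > 0\<close> by (intro order_tendstoD(1)[where y = "(1 + \<epsilon>) * 1"]) auto
    then obtain \<eta> :: real where \<eta>: "\<eta> > 0" "\<forall>x>0. x < \<eta> \<longrightarrow> 1 < (1 + \<epsilon>) * (sin x / x)"
      unfolding eventually_at_right_field by blast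
    define \<eta>' where "\<eta>' = min \<eta> (pi / 2)"
    \<comment> \<open>Nearby points must have nearby angles. The first term ensures this for
      half-differences up to \<open>pi / 2\<close>; the second excludes larger ones, whose sine is
      at least \<open>sin (\<tau> / 2)\<close>, a positive number as
      \<open>\<tau> < 2 * pi\<close>.\<close>
    define \<delta> where "\<delta> = min (sin \<eta>') (sin (\<tau> / 2))"
    have \<tau>: "0 < \<tau>" "\<tau> < 2 * pi" using True assms by (auto simp: \<tau>_def)
    have \<eta>': "0 < \<eta>'" "\<eta>' \<le> pi / 2" "\<eta>' \<le> \<eta>" using \<eta> by (auto simp: \<eta>'_def)
    have \<delta>: "\<delta> > 0" using \<tau> \<eta>' pi_gt_zero unfolding \<delta>_def
      by (simp only: min_less_iff_conj) (auto intro!: sin_gt_zero)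
    have key: "x \<le> (1 + \<epsilon>) * sin x" if x: "0 \<le> x" "x \<le> \<tau> / 2" "2 * sin x \<le> \<delta>" for x
    proof -
      have "x < \<eta>'"
      proof (rule ccontr)
        assume "\<not> x < \<eta>'"
        then have "\<delta> \<le> sin x"
        proof (cases "x \<le> pi / 2")
          case True
          then have "sin \<eta>' \<le> sin x" using \<eta>' \<open>\<not> x < \<eta>'\<close> by (intro sin_monotone_2pi_le) auto
          then show ?thesis by (simp add: \<delta>_def)
        next
          case False
          have "sin (pi - \<tau> / 2) \<le> sin (pi - x)"
            using x \<tau> False by (intro sin_monotone_2pi_le) auto
          then show ?thesis by (simp add: \<delta>_def)
        qed
        then show False using x \<delta> by linarith
      qed
      then show ?thesis
        using \<eta>(2)[rule_format, of x] \<eta>' x by (cases "x = 0") (auto simp: less_divide_eq)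
    qed
    have "\<bar>s - t\<bar> \<le> (1 + \<epsilon>) * dist (circle_pt c s) (circle_pt c t)"
      if st: "s \<in> {t1..t2}" "t \<in> {t1..t2}" "dist (circle_pt c s) (circle_pt c t) \<le> \<delta>" for s t
    proof -
      define x where "x = \<bar>s - t\<bar> / 2"
      have x: "0 \<le> x" "x \<le> \<tau> / 2" using st by (auto simp: x_def \<tau>_def abs_le_iff)
      have "\<bar>sin ((s - t) / 2)\<bar> = \<bar>sin x\<bar>"
        unfolding x_def using sin_minus[of "(s - t)/2"] by (auto simp: abs_if minus_divide_left)
      also have "\<dots> = sin x" using x \<tau> sin_ge_zero[of x] by simp
      finally have "dist (circle_pt c s) (circle_pt c t) = 2 * sin x" by (simp add: dist_circle_pt)
      then show ?thesis using key[OF x] st(3) by (simp add: x_def)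
    qed
    then show "\<exists>\<delta>>0. \<forall>x\<in>circle_pt c ` {t1..t2}. \<forall>y\<in>circle_pt c ` {t1..t2}.
        dist x y \<le> \<delta> \<longrightarrow> \<bar>f x - f y\<bar> \<le> (1 + \<epsilon>) * dist x y"
      using \<delta> by (intro exI[of _ \<delta>]) (auto simp: f)
  next
    show "{t1..t2} \<subseteq> f ` circle_pt c ` {t1..t2}"
      using f by (force simp: image_image)
  qed
  then show ?thesis using True by simp
qed (auto simp: ennreal_neg)

section \<open>Perimeters\<close>

text \<open>Inversion at the boundary point \<open>circle_pt c \<theta>\<close>, which neither path
  meets, maps the circle to a line and keeps the order of the angles. The four end points then
  alternate along the bottom edge of a box containing both images, the situation of Fashoda's
  theorem.\<close>

lemma paths_with_interlaced_endpoints_meet: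
  assumes "path f" "path g" and im: "path_image f \<subseteq> cball c 1" "path_image g \<subseteq> cball c 1"
    and w: "circle_pt c \<theta> \<notin> path_image f" "circle_pt c \<theta> \<notin> path_image g"
    and ends: "pathstart f = circle_pt c (\<theta> + t1)" "pathstart g = circle_pt c (\<theta> + t2)"
      "pathfinish f = circle_pt c (\<theta> + t3)" "pathfinish g = circle_pt c (\<theta> + t4)"
    and t: "0 < t1" "t1 < t2" "t2 < t3" "t3 < t4" "t4 < 2 * pi"
  shows "path_image f \<inter> path_image g \<noteq> {}"
proof -
  define w where "w = circle_pt c \<theta>"
  \<comment> \<open>\<open>G\<close> is inversion at \<open>w\<close> in a frame adapted to \<open>w\<close>; it sends the disk to an upper half-plane.\<close>
  define a where "a = (\<lambda>z. cos \<theta> * (z - w) $ 1 + sin \<theta> * (z - w) $ 2)"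
  define b where "b = (\<lambda>z. cos \<theta> * (z - w) $ 2 - sin \<theta> * (z - w) $ 1)"
  define r where "r = (\<lambda>z. (norm (z - w))\<^sup>2)"
  define G where "G = (\<lambda>z. (- b z / r z) *\<^sub>R axis 1 1 + (- a z / r z - 1/2) *\<^sub>R axis 2 1 :: real^2)"
  have G1: "G z $ 1 = - b z / r z" and G2: "G z $ 2 = - a z / r z - 1/2" for z
    by (auto simp: G_def axis_def)
  have ab: "(a z)\<^sup>2 + (b z)\<^sup>2 = r z" for z
  proof -
    have "(a z)\<^sup>2 + (b z)\<^sup>2 = (((z - w) $ 1)\<^sup>2 + ((z - w) $ 2)\<^sup>2) * ((sin \<theta>)\<^sup>2 + (cos \<theta>)\<^sup>2)"
      unfolding a_def b_def by algebra
    then show ?thesis by (simp add: r_def norm_vec2_sq)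
  qed
  have r_pos: "r z > 0" if "z \<noteq> w" for z using that by (simp add: r_def)
  have inj: "z = z'" if "G z = G z'" "z \<noteq> w" "z' \<noteq> w" for z z'
  proof -
    have e: "a z / r z = a z' / r z'" "b z / r z = b z' / r z'"
      using that(1) G1[of z] G1[of z'] G2[of z] G2[of z'] by auto
    \<comment> \<open>Up to the shift by 1/2, the image of \<open>z\<close> has squared norm
      \<open>1 / r z\<close>. So \<open>r\<close> is recovered from the image first, and then
      \<open>a\<close> and \<open>b\<close>.\<close>
    have "(a z / r z)\<^sup>2 + (b z / r z)\<^sup>2 = r z / (r z)\<^sup>2" for z
      by (simp only: power_divide add_divide_distrib[symmetric] ab)
    then have "r z / (r z)\<^sup>2 = r z' / (r z')\<^sup>2" using e by metis
    then have r: "r z = r z'"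
      using r_pos[OF that(2)] r_pos[OF that(3)] by (simp add: power2_eq_square)
    have "a z = a z'" "b z = b z'" using e r r_pos[OF that(3)] by auto
    moreover have "(z - w) $ 1 * ((sin \<theta>)\<^sup>2 + (cos \<theta>)\<^sup>2) = cos \<theta> * a z - sin \<theta> * b z"
      "(z - w) $ 2 * ((sin \<theta>)\<^sup>2 + (cos \<theta>)\<^sup>2) = sin \<theta> * a z + cos \<theta> * b z" for z
      unfolding a_def b_def by algebra+
    ultimately have "(z - w) $ 1 = (z' - w) $ 1" "(z - w) $ 2 = (z' - w) $ 2"
      by (metis mult.right_neutral sin_cos_squared_add)+
    then show "z = z'" by (simp add: vec_eq_iff forall_2)
  qed
  have cont: "continuous_on X G" if "w \<notin> X" for X
    unfolding G_def a_def b_def r_def using that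
    by (intro continuous_intros) auto
  have half: "0 \<le> G z $ 2" if "z \<in> cball c 1" "z \<noteq> w" for z
  proof -
    have "(norm (z - c))\<^sup>2 \<le> 1" using that by (simp add: dist_norm norm_minus_commute abs_square_le_1)
    \<comment> \<open>In the adapted frame the disk is \<open>r z + 2 * a z \<le> 0\<close>, that
      is, \<open>- a z / r z \<ge> 1/2\<close>; hence the 1/2 subtracted in
      \<open>G\<close>.\<close>
    moreover have "(norm (z - c))\<^sup>2 = r z + 2 * a z + ((sin \<theta>)\<^sup>2 + (cos \<theta>)\<^sup>2)"
      unfolding r_def norm_vec2_sq a_def w_def by (simp add: algebra_simps power2_eq_square)
    ultimately have "r z + 2 * a z \<le> 0" by simp
    then show ?thesis using r_pos[OF that(2)] by (simp add: G2 field_simps)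
  qed
  have circ: "G (circle_pt c (\<theta> + t)) $ 2 = 0" "G (circle_pt c (\<theta> + t)) $ 1 = - (cos (t/2) / sin (t/2)) / 2"
    if "0 < t" "t < 2 * pi" for t
  proof -
    let ?z = "circle_pt c (\<theta> + t)"
    have s: "sin (t/2) > 0" using that by (intro sin_gt_zero) auto
    have az: "a ?z = cos t - 1"
    proof -
      have "a ?z = (cos t - 1) * ((sin \<theta>)\<^sup>2 + (cos \<theta>)\<^sup>2)"
        unfolding a_def w_def vector_minus_component circle_pt_nth cos_add sin_add by algebra
      then show ?thesis by simp
    qed
    have bz: "b ?z = sin t"
    proof -
      have "b ?z = sin t * ((sin \<theta>)\<^sup>2 + (cos \<theta>)\<^sup>2)"
        unfolding b_def w_def vector_minus_component circle_pt_nth cos_add sin_add by algebra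
      then show ?thesis by simp
    qed
    have t2: "cos t = 1 - 2 * (sin (t/2))\<^sup>2" "sin t = 2 * sin (t/2) * cos (t/2)"
      using cos_double_sin[of "t/2"] sin_double[of "t/2"] by simp_all
    have rz: "r ?z = 4 * (sin (t/2))\<^sup>2"
      unfolding r_def w_def dist_norm[symmetric] dist_circle_pt by (simp add: power_mult_distrib)
    show "G ?z $ 2 = 0" using s by (simp add: G2 az rz t2)
    show "G ?z $ 1 = - (cos (t/2) / sin (t/2)) / 2"
      using s by (simp add: G1 bz rz t2 power2_eq_square)
  qed
  \<comment> \<open>The first coordinate is minus half the cotangent of the half angle. The
    difference of two cotangents has the sine of the angle difference as its numerator, which fixes
    the sign.\<close>
  have mono: "G (circle_pt c (\<theta> + s)) $ 1 < G (circle_pt c (\<theta> + t)) $ 1"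
    if "0 < s" "s < t" "t < 2 * pi" for s t
  proof -
    have "sin (s/2) > 0" "sin (t/2) > 0" using that by (auto intro!: sin_gt_zero)
    moreover have "sin (t/2) * cos (s/2) - cos (t/2) * sin (s/2) > 0"
      unfolding sin_diff[symmetric] using that by (intro sin_gt_zero) auto
    ultimately have "cos (t/2) / sin (t/2) < cos (s/2) / sin (s/2)"
      by (simp add: field_simps)
    then show ?thesis using that by (simp add: circ)
  qed
  have wf: "w \<notin> path_image f" "w \<notin> path_image g" using w by (auto simp: w_def)
  have pf: "path (G \<circ> f)" "path (G \<circ> g)"
    using assms cont wf by (auto intro!: path_continuous_image)
  define X where "X = path_image (G \<circ> f) \<union> path_image (G \<circ> g)"
  have "bounded X"
    unfolding X_def using pf by (auto intro: bounded_path_image)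
  then obtain R where R: "\<And>x. x \<in> X \<Longrightarrow> norm x \<le> R" by (auto simp: bounded_iff)
  have X: "X \<subseteq> cbox ((- R) *\<^sub>R axis 1 1) (R *\<^sub>R axis 1 1 + R *\<^sub>R axis 2 1 :: real^2)"
  proof
    fix x assume x: "x \<in> X"
    have "\<bar>x $ 1\<bar> \<le> R" "\<bar>x $ 2\<bar> \<le> R"
      using R[OF x] component_le_norm_cart order_trans by blast+
    moreover obtain y where y: "y \<in> path_image f \<union> path_image g" "x = G y"
      using x unfolding X_def path_image_compose by auto
    have "y \<in> cball c 1" "y \<noteq> w" using y(1) im wf by auto
    then have "0 \<le> x $ 2" unfolding y(2) by (rule half)
    ultimately show "x \<in> cbox ((- R) *\<^sub>R axis 1 1) (R *\<^sub>R axis 1 1 + R *\<^sub>R axis 2 1 :: real^2)"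
      by (auto simp: mem_box_cart forall_2 axis_def)
  qed
  obtain z where z: "z \<in> path_image (G \<circ> f)" "z \<in> path_image (G \<circ> g)"
  proof (rule fashoda_interlace[OF pf, of "(- R) *\<^sub>R axis 1 1" "R *\<^sub>R axis 1 1 + R *\<^sub>R axis 2 1"])
    show "path_image (G \<circ> f) \<subseteq> cbox ((- R) *\<^sub>R axis 1 1) (R *\<^sub>R axis 1 1 + R *\<^sub>R axis 2 1)"
      "path_image (G \<circ> g) \<subseteq> cbox ((- R) *\<^sub>R axis 1 1) (R *\<^sub>R axis 1 1 + R *\<^sub>R axis 2 1)"
      using X by (auto simp: X_def)
  qed (use t in \<open>auto simp: pathstart_compose pathfinish_compose ends circ(1) mono axis_def\<close>)
  then obtain x y where "x \<in> path_image f" "y \<in> path_image g" "G x = G y"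
    by (auto simp: path_image_compose)
  then show ?thesis using inj wf by blast
qed

text \<open>\<open>V\<close> is the image of the open ball, open by invariance of domain. The
  joining paths are images of segments in the closed ball, which by strict convexity touch the
  sphere at most at their ends.\<close>

lemma homeomorphic_cball_subset_cball:
  fixes K :: "'a::euclidean_space set"
  assumes "K homeomorphic cball c 1" "K \<subseteq> cball c 1"
  obtains V where "open V" "connected V" "V \<subseteq> ball c 1" "K = closure V"
    "\<And>x y. x \<in> K \<Longrightarrow> y \<in> K \<Longrightarrow> \<exists>g. path g \<and> pathstart g = x \<and> pathfinish g = y \<and> path_image g \<subseteq> V \<union> {x, y}"
proof -
  obtain h k where hk: "homeomorphism (cball c 1) K h k"
    using assms(1) homeomorphic_sym unfolding homeomorphic_def by blast
  have h: "continuous_on (cball c 1) h" "h ` cball c 1 = K" "\<And>x. x \<in> cball c 1 \<Longrightarrow> k (h x) = x"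
    using hk by (auto simp: homeomorphism_def)
  have inj: "inj_on h (cball c 1)" using h(3) by (metis inj_onI)
  define V where "V = h ` ball c 1"
  have cb: "continuous_on (ball c 1) h" using h(1) ball_subset_cball continuous_on_subset by blast
  have "open V"
    unfolding V_def using cb inj by (intro invariance_of_domain) (auto intro: inj_on_subset)
  moreover have "connected V"
    unfolding V_def using cb by (intro connected_continuous_image) auto
  moreover have VK: "V \<subseteq> K" unfolding V_def using h(2) ball_subset_cball by blast
  have "V \<subseteq> interior (cball c 1)"
    using VK assms(2) \<open>open V\<close> by (intro interior_maximal) auto
  then have "V \<subseteq> ball c 1" by simp
  moreover have "K = closure V"
  proof
    have "compact K" using h(1,2) compact_continuous_image compact_cball by blast
    then show "closure V \<subseteq> K" using VK by (simp add: closure_minimal compact_imp_closed)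
    have "h ` closure (ball c 1) \<subseteq> closure V"
      using h(1) by (intro image_closure_subset) (auto simp: V_def closure_subset)
    then show "K \<subseteq> closure V" using h(2) by simp
  qed
  moreover have "\<exists>g. path g \<and> pathstart g = x \<and> pathfinish g = y \<and> path_image g \<subseteq> V \<union> {x, y}"
    if "x \<in> K" "y \<in> K" for x y
  proof -
    obtain x0 y0 where xy: "x0 \<in> cball c 1" "h x0 = x" "y0 \<in> cball c 1" "h y0 = y"
      using \<open>x \<in> K\<close> \<open>y \<in> K\<close> h(2) by blast
    have seg: "closed_segment x0 y0 \<subseteq> ball c 1 \<union> {x0, y0}"
    proof
      fix z assume z: "z \<in> closed_segment x0 y0"
      show "z \<in> ball c 1 \<union> {x0, y0}"
      proof (cases "z \<in> open_segment x0 y0")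
        case True
        then show ?thesis using dist_decreases_open_segment[of z x0 y0 c] xy by auto
      next
        case False
        then show ?thesis using z by (auto simp: open_segment_def)
      qed
    qed
    have "closed_segment x0 y0 \<subseteq> cball c 1"
      using xy by (intro closed_segment_subset) auto
    then have "path (h \<circ> linepath x0 y0)"
      using h(1) continuous_on_subset by (intro path_continuous_image) auto
    moreover have "path_image (h \<circ> linepath x0 y0) \<subseteq> V \<union> {x, y}"
      using seg xy by (auto simp: path_image_compose V_def)
    ultimately show ?thesis
      using xy by (intro exI[of _ "h \<circ> linepath x0 y0"]) (auto simp: pathstart_compose pathfinish_compose)
  qed
  ultimately show ?thesis by (rule that)
qed

section \<open>Length of the common boundary inside the disk\<close>

lemma connected_meets_hyperplane:
  fixes V :: "'a::euclidean_space set"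
  assumes "connected V" "p \<in> closure V" "q \<in> closure V" "u \<bullet> p < s" "s < u \<bullet> q"
  obtains z where "z \<in> V" "u \<bullet> z = s"
proof -
  have "{x. u \<bullet> x < s} \<inter> V \<noteq> {}"
    using assms open_Int_closure_eq_empty[OF open_halfspace_lt[of u s], of V] by auto
  moreover have "{x. u \<bullet> x > s} \<inter> V \<noteq> {}"
    using assms open_Int_closure_eq_empty[OF open_halfspace_gt[of s u], of V] by auto
  ultimately obtain x y where "x \<in> V" "u \<bullet> x < s" "y \<in> V" "u \<bullet> y > s" by blast
  then show ?thesis
    using connected_ivt_hyperplane[OF assms(1), of x y u s] that by auto
qed

text \<open>\<open>V\<close> and \<open>W\<close> both reach the hyperplane, and the segment joining
  the two points stays in the hyperplane and in the open ball. Being connected and covered by two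
  closed sets that both meet it, the segment meets their intersection.\<close>

lemma common_boundary_meets_chord:
  fixes V W :: "'a::euclidean_space set"
  assumes "connected V" "connected W" "V \<subseteq> ball c 1" "W \<subseteq> ball c 1"
    and cover: "cball c 1 \<subseteq> closure V \<union> closure W"
    and pq: "p \<in> closure V \<inter> closure W" "q \<in> closure V \<inter> closure W" "u \<bullet> p < s" "s < u \<bullet> q"
  obtains z where "z \<in> closure V \<inter> closure W \<inter> ball c 1" "u \<bullet> z = s"
proof -
  obtain x where x: "x \<in> V" "u \<bullet> x = s" using connected_meets_hyperplane[OF assms(1)] pq by blast
  obtain y where y: "y \<in> W" "u \<bullet> y = s" using connected_meets_hyperplane[OF assms(2)] pq by blast
  let ?I = "closed_segment x y"
  have I: "?I \<subseteq> ball c 1" using x y assms(3,4) by (intro closed_segment_subset) auto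
  have Is: "?I \<subseteq> {z. u \<bullet> z = s}"
    using x y by (intro closed_segment_subset) (auto simp: convex_hyperplane)
  have "?I \<subseteq> closure V \<union> closure W" using I cover ball_subset_cball by blast
  moreover have "x \<in> closure V \<inter> ?I" "y \<in> closure W \<inter> ?I"
    using x y closure_subset by auto
  ultimately have "closure V \<inter> closure W \<inter> ?I \<noteq> {}"
    using connected_segment(1)[of x y] unfolding connected_closed by (metis closed_closure empty_iff)
  then show ?thesis using that I Is by blast
qed

text \<open>Projected to the chord direction, the common boundary inside the open disk covers an
  open interval as long as the chord. To add this to the length of the arc, that part is exhausted
  by compact sets away from the circle.\<close>

lemma hausdorff1_arc_and_common_boundary_ge:
  assumes "connected V" "connected W" "V \<subseteq> ball c 1" "W \<subseteq> ball c 1"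
    and cover: "cball c 1 \<subseteq> closure V \<union> closure W"
    and pq: "circle_pt c t1 \<in> closure V \<inter> closure W" "circle_pt c t2 \<in> closure V \<inter> closure W"
    and t: "t1 \<le> t2" "t2 - t1 < 2 * pi"
    and F: "circle_pt c ` {t1..t2} \<subseteq> F" "closure V \<inter> closure W \<subseteq> F"
  shows "ennreal (t2 - t1 + 2 * sin ((t2 - t1) / 2)) \<le> hausdorff1 F"
proof -
  define p q where "p = circle_pt c t1" and "q = circle_pt c t2"
  define d where "d = dist p q"
  have sin0: "0 \<le> sin ((t2 - t1) / 2)" using t by (intro sin_ge_zero) auto
  have d: "d = 2 * sin ((t2 - t1) / 2)"
    using sin0 sin_minus[of "(t2 - t1) / 2"] by (simp add: d_def p_def q_def dist_circle_pt minus_divide_left)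
  \<comment> \<open>If \<open>p = q\<close>, then \<open>1 / d\<close> is 0 and \<open>u\<close> is
    the zero vector; the two facts about \<open>u\<close> that follow cover this case as
    well.\<close>
  define u where "u = (1 / d) *\<^sub>R (q - p)"
  have u: "u \<bullet> q - u \<bullet> p = d"
  proof -
    have "u \<bullet> q - u \<bullet> p = (1 / d) * ((q - p) \<bullet> (q - p))"
      by (simp add: u_def inner_diff_right diff_divide_distrib)
    also have "\<dots> = (1 / d) * d\<^sup>2"
      by (simp only: power2_norm_eq_inner[symmetric] d_def dist_norm norm_minus_commute)
    also have "\<dots> = d" by (simp add: power2_eq_square)
    finally show ?thesis .
  qed
  have nu: "norm u \<le> 1"
    by (simp add: u_def d_def dist_norm norm_minus_commute)
  \<comment> \<open>Compact, increasing, disjoint from the circle, and together all of the common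
    boundary in the open disk.\<close>
  define M where "M = (\<lambda>n. closure V \<inter> closure W \<inter> cball c (1 - 1 / real (Suc n)))"
  define E where "E = (\<lambda>n. (\<lambda>z. u \<bullet> z) ` M n)"
  have cM: "compact (M n)" for n
    unfolding M_def by (intro closed_Int_compact) auto
  have cE: "compact (E n)" for n
    unfolding E_def by (intro compact_continuous_image cM continuous_intros)
  have incM: "M m \<subseteq> M n" if "m \<le> n" for m n
  proof -
    have "1 / real (Suc n) \<le> 1 / real (Suc m)" using that by (simp add: frac_le)
    then show ?thesis unfolding M_def by auto
  qed
  have HM: "emeasure lborel (E n) \<le> hausdorff1 (M n)" for n
  proof (rule emeasure_image_le_hausdorff1[where f = "\<lambda>z. u \<bullet> z"])
    fix \<epsilon> :: real assume "\<epsilon> > 0"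
    have "\<bar>u \<bullet> z - u \<bullet> z'\<bar> \<le> (1 + \<epsilon>) * dist z z'" for z z'
    proof -
      have "\<bar>u \<bullet> z - u \<bullet> z'\<bar> \<le> norm u * norm (z - z')"
        by (metis Cauchy_Schwarz_ineq2 inner_diff_right)
      also have "\<dots> \<le> (1 + \<epsilon>) * dist z z'"
        using nu \<open>\<epsilon> > 0\<close> by (auto simp: dist_norm intro!: mult_right_mono)
      finally show ?thesis .
    qed
    then show "\<exists>\<delta>>0. \<forall>x\<in>M n. \<forall>y\<in>M n. dist x y \<le> \<delta> \<longrightarrow> \<bar>u \<bullet> x - u \<bullet> y\<bar> \<le> (1 + \<epsilon>) * dist x y"
      by (intro exI[of _ 1]) auto
  qed (simp add: E_def)
  have "{u \<bullet> p<..<u \<bullet> q} \<subseteq> (\<Union>n. E n)"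
  proof
    fix s assume "s \<in> {u \<bullet> p<..<u \<bullet> q}"
    then obtain z where z: "z \<in> closure V \<inter> closure W \<inter> ball c 1" "u \<bullet> z = s"
      using common_boundary_meets_chord[OF assms(1-5), of p q u s] pq by (auto simp: p_def q_def)
    then have "dist c z < 1" by auto
    then obtain n where "1 / real (Suc n) < 1 - dist c z"
      using reals_Archimedean[of "1 - dist c z"] by (auto simp: inverse_eq_divide)
    then have "z \<in> M n" using z by (auto simp: M_def)
    then show "s \<in> (\<Union>n. E n)" using z by (auto simp: E_def)
  qed
  then have "emeasure lborel {u \<bullet> p<..<u \<bullet> q} \<le> emeasure lborel (\<Union>n. E n)"
    using cE by (intro emeasure_mono sets.countable_UN) (auto intro!: borel_compact)
  also have "\<dots> = (SUP n. emeasure lborel (E n))"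
    using cE incM by (intro SUP_emeasure_incseq[symmetric])
      (auto simp: incseq_def E_def intro!: borel_compact image_mono)
  finally have "ennreal d \<le> (SUP n. emeasure lborel (E n))"
    using u sin0 d by (simp add: algebra_simps)
  then have "ennreal (t2 - t1) + ennreal d \<le> ennreal (t2 - t1) + (SUP n. emeasure lborel (E n))"
    by (intro add_left_mono)
  also have "\<dots> = (SUP n. ennreal (t2 - t1) + emeasure lborel (E n))"
    by (rule ennreal_SUP_add_right) simp
  also have "\<dots> \<le> hausdorff1 F"
  proof (rule SUP_least)
    fix n
    have "ennreal (t2 - t1) + emeasure lborel (E n) \<le> hausdorff1 (circle_pt c ` {t1..t2}) + hausdorff1 (M n)"
      using t by (intro add_mono hausdorff1_arc_ge HM)
    also have "\<dots> \<le> hausdorff1 (circle_pt c ` {t1..t2} \<union> M n)"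
    proof (rule hausdorff1_Un_compact_ge)
      show "compact (circle_pt c ` {t1..t2})"
        by (intro compact_continuous_image continuous_intros) auto
      have "0 < 1 / real (Suc n)" by simp
      then have "x \<notin> cball c (1 - 1 / real (Suc n))" if "x \<in> sphere c 1" for x
        using that by (simp add: mem_sphere)
      then show "circle_pt c ` {t1..t2} \<inter> M n = {}"
        unfolding M_def using circle_pt_in_sphere by blast
    qed (rule cM)
    also have "\<dots> \<le> hausdorff1 F"
      using F by (intro hausdorff1_mono) (auto simp: M_def)
    finally show "ennreal (t2 - t1) + emeasure lborel (E n) \<le> hausdorff1 F" .
  qed
  finally show ?thesis
    using t sin0 by (simp add: d ennreal_plus)
qed

section \<open>The lower bound for the larger perimeter\<close>

lemma add_twice_sin_half_ge:
  assumes "pi \<le> \<tau>" "\<tau> \<le> 2 * pi"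
  shows "pi + 2 \<le> \<tau> + 2 * sin (\<tau> / 2)"
proof -
  have "pi + 2 * sin (pi / 2) \<le> \<tau> + 2 * sin (\<tau> / 2)"
  proof (rule DERIV_nonneg_imp_nondecreasing[OF assms(1)])
    fix x :: real
    have "DERIV (\<lambda>x. x + 2 * sin (x / 2)) x :> 1 + cos (x / 2)"
      by (auto intro!: derivative_eq_intros)
    moreover have "0 \<le> 1 + cos (x / 2)" using cos_ge_minus_one[of "x / 2"] by linarith
    ultimately show "\<exists>y. DERIV (\<lambda>x. x + 2 * sin (x / 2)) x :> y \<and> 0 \<le> y" by blast
  qed
  then show ?thesis by simp
qed

text \<open>An arc of length \<open>pi + 2\<close> is shorter than the full circle, as
  \<open>2 < pi\<close>, so the estimate for arcs applies to it.\<close>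

lemma hausdorff1_sphere_subset_ge:
  fixes c :: "real^2"
  assumes "sphere c 1 \<subseteq> F"
  shows "ennreal (pi + 2) \<le> hausdorff1 F"
proof -
  have "ennreal (pi + 2 - 0) \<le> hausdorff1 (circle_pt c ` {0..pi + 2})"
    using pi_gt3 by (intro hausdorff1_arc_ge) auto
  also have "\<dots> \<le> hausdorff1 F"
    using assms circle_pt_in_sphere by (intro hausdorff1_mono) blast
  finally show ?thesis by simp
qed

theorem disk_partition_perimeter_ge:
  assumes "disk_partition (cball c 1) A B"
  shows "ennreal (pi + 2) \<le> max (perimeter A) (perimeter B)"
proof -
  let ?K = "closure A" and ?L = "closure B" and ?S = "sphere c 1"
  have AB: "A \<union> B = cball c 1" "A \<inter> B = {}" "?K homeomorphic cball c 1" "?L homeomorphic cball c 1"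
    using assms by (auto simp: disk_partition_def)
  have KL: "?K \<union> ?L = cball c 1" using AB(1) by (metis closure_Un closed_cball closure_closed)
  obtain V where V: "open V" "connected V" "V \<subseteq> ball c 1" "?K = closure V"
    "\<And>x y. x \<in> ?K \<Longrightarrow> y \<in> ?K \<Longrightarrow> \<exists>g. path g \<and> pathstart g = x \<and> pathfinish g = y \<and> path_image g \<subseteq> V \<union> {x, y}"
    using homeomorphic_cball_subset_cball[OF AB(3)] KL by blast
  obtain W where W: "open W" "connected W" "W \<subseteq> ball c 1" "?L = closure W"
    "\<And>x y. x \<in> ?L \<Longrightarrow> y \<in> ?L \<Longrightarrow> \<exists>g. path g \<and> pathstart g = x \<and> pathfinish g = y \<and> path_image g \<subseteq> W \<union> {x, y}"
    using homeomorphic_cball_subset_cball[OF AB(4)] KL by blast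
  have common: "?K \<inter> ?L \<subseteq> frontier A" "?K \<inter> ?L \<subseteq> frontier B"
  proof -
    have "interior A \<inter> ?L = {}" "interior B \<inter> ?K = {}"
      using AB(2) interior_subset by (auto simp: open_Int_closure_eq_empty)
    then show "?K \<inter> ?L \<subseteq> frontier A" "?K \<inter> ?L \<subseteq> frontier B" by (auto simp: frontier_def)
  qed
  have circ: "?K \<inter> ?S \<subseteq> frontier A" "?L \<inter> ?S \<subseteq> frontier B"
  proof -
    have "interior A \<subseteq> ball c 1" "interior B \<subseteq> ball c 1"
      using AB(1) interior_mono[of _ "cball c 1"] by (metis Un_upper1 Un_upper2 interior_cball)+
    then show "?K \<inter> ?S \<subseteq> frontier A" "?L \<inter> ?S \<subseteq> frontier B" by (auto simp: frontier_def)
  qed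
  have in_KL: "circle_pt c t \<in> ?K \<or> circle_pt c t \<in> ?L" for t
    using KL circle_pt_in_sphere[of c t] sphere_cball by blast
  \<comment> \<open>The first three cases are degenerate: overlapping open sets, or the whole circle
    in one closure. In the last case each closure misses a point of the circle.\<close>
  consider "V \<inter> W \<noteq> {}" | "?S \<subseteq> ?K" | "?S \<subseteq> ?L" | "V \<inter> W = {}" "\<not> ?S \<subseteq> ?K" "\<not> ?S \<subseteq> ?L" by blast
  then show ?thesis
  proof cases
    case 1
    have "V \<inter> W \<subseteq> interior (frontier A)"
    proof (intro interior_maximal open_Int)
      have "V \<subseteq> ?K" "W \<subseteq> ?L" using V(4) W(4) closure_subset by auto
      then show "V \<inter> W \<subseteq> frontier A" using common by blast
    qed (use V W in auto)
    then have "perimeter A = top"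
      unfolding perimeter_def using 1 by (intro hausdorff1_eq_top_of_interior) auto
    then show ?thesis by simp
  next
    case 2
    then have "?S \<subseteq> frontier A" using circ by blast
    then show ?thesis
      using hausdorff1_sphere_subset_ge by (auto simp: perimeter_def max.coboundedI1)
  next
    case 3
    then have "?S \<subseteq> frontier B" using circ by blast
    then show ?thesis
      using hausdorff1_sphere_subset_ge by (auto simp: perimeter_def max.coboundedI2)
  next
    case 4
    then obtain w where "w \<in> ?S" "w \<notin> ?K" by blast
    \<comment> \<open>Angles are measured from a point outside \<open>?K\<close>, so those of the
      points of \<open>?K\<close> on the circle lie strictly between 0 and \<open>2 * pi\<close> and
      nothing wraps around.\<close>
    then obtain \<theta> where \<theta>: "circle_pt c \<theta> \<notin> ?K"
      using circle_pt_surj[of w c 0] by auto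
    let ?g = "\<lambda>t. circle_pt c (\<theta> + t)"
    have per: "?g (t + 2 * pi) = ?g t" for t
      using sin_periodic[of "\<theta> + t"] cos_periodic[of "\<theta> + t"] by (simp add: circle_pt_def add.assoc)
    define T where "T = {t \<in> {0..2 * pi}. ?g t \<in> ?K}"
    have cg: "continuous_on X ?g" for X by (intro continuous_intros)
    have "T = {0..2 * pi} \<inter> ?g -` ?K" by (auto simp: T_def)
    then have "closed T"
      using continuous_closed_preimage[OF cg, of "{0..2 * pi}" ?K] by simp
    moreover have "bounded T" by (rule bounded_subset[of "{0..2 * pi}"]) (auto simp: T_def)
    ultimately have "compact T" by (simp add: compact_eq_bounded_closed)
    obtain x where x: "x \<in> ?S" "x \<notin> ?L" using 4 by blast
    obtain s where "0 \<le> s" "s < 2 * pi" "x = ?g s" using circle_pt_surj[OF x(1)] by blast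
    then have "s \<in> T" using in_KL[of "\<theta> + s"] x(2) by (simp add: T_def)
    then have "T \<noteq> {}" by blast
    obtain t1 where t1: "t1 \<in> T" "\<And>t. t \<in> T \<Longrightarrow> t1 \<le> t"
      using compact_attains_inf[OF \<open>compact T\<close> \<open>T \<noteq> {}\<close>] by auto
    obtain t2 where t2: "t2 \<in> T" "\<And>t. t \<in> T \<Longrightarrow> t \<le> t2"
      using compact_attains_sup[OF \<open>compact T\<close> \<open>T \<noteq> {}\<close>] by auto
    have "0 \<notin> T" "2 * pi \<notin> T" using \<theta> per[of 0] by (auto simp: T_def)
    then have "t1 \<noteq> 0" "t2 \<noteq> 2 * pi" using t1(1) t2(1) by auto
    moreover have "0 \<le> t1" "t2 \<le> 2 * pi" using t1(1) t2(1) by (simp_all add: T_def)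
    ultimately have t: "0 < t1" "t1 \<le> t2" "t2 < 2 * pi"
      using t1(2)[OF t2(1)] by simp_all
    have L: "?g t \<in> ?L" if "0 \<le> t" "t \<le> 2 * pi" "t \<notin> T" for t
      using that in_KL by (auto simp: T_def)
    \<comment> \<open>No angle before \<open>t1\<close> belongs to \<open>T\<close>, so these points
      lie in \<open>?L\<close>. Closedness of \<open>?L\<close> adds the end point, which therefore
      belongs to both closures; the same happens at \<open>t2\<close>.\<close>
    have L1: "?g ` {0..t1} \<subseteq> ?L"
    proof -
      have "?g s \<in> ?L" if "s \<in> {0<..<t1}" for s
        using t1(2)[of s] that t by (intro L) auto
      then have "?g ` closure {0<..<t1} \<subseteq> ?L"
        using cg by (intro image_closure_subset) auto
      then show ?thesis using t by simp
    qed
    have L2: "?g ` {t2..2 * pi} \<subseteq> ?L"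
    proof -
      have "?g s \<in> ?L" if "s \<in> {t2<..<2 * pi}" for s
        using t2(2)[of s] that t by (intro L) auto
      then have "?g ` closure {t2<..<2 * pi} \<subseteq> ?L"
        using cg by (intro image_closure_subset) auto
      then show ?thesis using t by simp
    qed
    have "?g t1 \<in> ?K" "?g t2 \<in> ?K" using t1(1) t2(1) by (simp_all add: T_def)
    moreover have "?g t1 \<in> ?L" "?g t2 \<in> ?L" using t L1 L2 by (auto simp: image_subset_iff)
    ultimately have pq: "?g t1 \<in> ?K \<inter> ?L" "?g t2 \<in> ?K \<inter> ?L" by auto
    \<comment> \<open>With a single angle in \<open>T\<close> the whole circle would lie in
      \<open>?L\<close>.\<close>
    have "t1 \<noteq> t2"
    proof
      assume "t1 = t2"
      have "?S \<subseteq> ?L"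
      proof
        fix y assume "y \<in> ?S"
        then obtain s where "0 \<le> s" "s < 2 * pi" "y = ?g s" by (rule circle_pt_surj)
        moreover have "s = t1" if "s \<in> T" using t1(2)[OF that] t2(2)[OF that] \<open>t1 = t2\<close> by simp
        ultimately show "y \<in> ?L" using L[of s] pq by (cases "s \<in> T") auto
      qed
      then show False using 4 by blast
    qed
    then have lt: "t1 < t2" using t by simp
    \<comment> \<open>A gap of \<open>T\<close> between \<open>t1\<close> and \<open>t2\<close>
      would give interlacing pairs of points, one joined through \<open>V\<close> and the other
      through \<open>W\<close>; the paths would cross at a point of both open sets.\<close>
    have K: "?g s \<in> ?K" if s: "s \<in> {t1..t2}" for s
    proof (rule ccontr)
      assume nK: "?g s \<notin> ?K"
      have "s \<noteq> t1" "s \<noteq> t2" using nK pq by auto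
      then have s12: "t1 < s" "s < t2" using s by auto
      \<comment> \<open>Any angle strictly between \<open>t2\<close> and \<open>2 * pi\<close> lies
        beyond \<open>T\<close> and can serve as the fourth point; the midpoint is taken.\<close>
      define t4 where "t4 = (t2 + 2 * pi) / 2"
      have t4: "t2 < t4" "t4 < 2 * pi" using t by (auto simp: t4_def)
      have nK4: "?g t4 \<notin> ?K" using t2(2)[of t4] t4 t by (auto simp: T_def)
      obtain f where f: "path f" "pathstart f = ?g t1" "pathfinish f = ?g t2" "path_image f \<subseteq> V \<union> {?g t1, ?g t2}"
        using V(5) pq by blast
      obtain g where g: "path g" "pathstart g = ?g s" "pathfinish g = ?g t4" "path_image g \<subseteq> W \<union> {?g s, ?g t4}"
        using W(5) in_KL nK nK4 by metis
      have V': "V \<subseteq> ?K" "W \<subseteq> ?L" using V(4) W(4) closure_subset by auto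
      have sph: "?g s' \<notin> ball c 1" for s' using circle_pt_in_sphere[of c "\<theta> + s'"] by (simp del: circle_pt_in_sphere)
      have "path_image f \<inter> path_image g \<noteq> {}"
      proof (rule paths_with_interlaced_endpoints_meet[OF f(1) g(1), of c \<theta> t1 s t2 t4])
        have "V \<union> {?g t1, ?g t2} \<subseteq> ?K" using V'(1) pq by simp
        then have fK: "path_image f \<subseteq> ?K" using f(4) by (rule order_trans[rotated])
        then show "path_image f \<subseteq> cball c 1" using KL by auto
        show "circle_pt c \<theta> \<notin> path_image f" using fK \<theta> by auto
        have "?g s \<in> ?L" "?g t4 \<in> ?L" using in_KL nK nK4 by blast+
        then have "W \<union> {?g s, ?g t4} \<subseteq> cball c 1" using V'(2) KL by auto
        then show "path_image g \<subseteq> cball c 1" using g(4) by (rule order_trans[rotated])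
        have neq: "circle_pt c \<theta> \<noteq> ?g s'" if "0 < s'" "s' < 2 * pi" for s'
          using circle_pt_inj[of c \<theta> "\<theta> + s'"] that by auto
        have "circle_pt c \<theta> \<noteq> ?g s" "circle_pt c \<theta> \<noteq> ?g t4"
          using s12 t t4 by (intro neq; simp)+
        moreover have "circle_pt c \<theta> \<notin> W" using sph[of 0] W(3) by auto
        ultimately have "circle_pt c \<theta> \<notin> W \<union> {?g s, ?g t4}" by simp
        then show "circle_pt c \<theta> \<notin> path_image g" using g(4) by auto
      qed (use f(2,3) g(2,3) s12 t t4 in simp_all)
      then obtain z where "z \<in> path_image f" "z \<in> path_image g" by blast
      then have z: "z \<in> V \<union> {?g t1, ?g t2}" "z \<in> W \<union> {?g s, ?g t4}" using f(4) g(4) by auto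
      \<comment> \<open>The crossing point is none of the four end points: \<open>?g s\<close> and
        \<open>?g t4\<close> are outside \<open>?K\<close>, and the other two lie on the circle,
        which \<open>W\<close> avoids.\<close>
      have "z \<in> ?K" using z(1) V'(1) pq by auto
      then have "z \<noteq> ?g s" "z \<noteq> ?g t4" using nK nK4 by auto
      then have "z \<in> W" using z(2) by simp
      then have "z \<noteq> ?g t1" "z \<noteq> ?g t2" using sph W(3) by auto
      then have "z \<in> V" using z(1) by simp
      then show False using \<open>z \<in> W\<close> 4(1) by auto
    qed
    have cover: "cball c 1 \<subseteq> closure V \<union> closure W" using KL V(4) W(4) by auto
    define \<tau> where "\<tau> = t2 - t1"
    show ?thesis
    \<comment> \<open>Of the two complementary arcs one has length at least \<open>pi\<close>; it
      belongs to the boundary of \<open>A\<close> or of \<open>B\<close> accordingly.\<close>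
    proof (cases "pi \<le> \<tau>")
      case True
      have eq: "(\<theta> + t2) - (\<theta> + t1) = \<tau>" by (simp add: \<tau>_def)
      have ge: "ennreal ((\<theta> + t2) - (\<theta> + t1) + 2 * sin (((\<theta> + t2) - (\<theta> + t1)) / 2)) \<le> hausdorff1 (frontier A)"
      proof (rule hausdorff1_arc_and_common_boundary_ge[OF V(2) W(2) V(3) W(3) cover])
        show "circle_pt c ` {\<theta> + t1..\<theta> + t2} \<subseteq> frontier A"
        proof
          fix y assume "y \<in> circle_pt c ` {\<theta> + t1..\<theta> + t2}"
          then obtain s where s: "s \<in> {\<theta> + t1..\<theta> + t2}" "y = circle_pt c s" by auto
          then have "y \<in> ?K" using K[of "s - \<theta>"] by auto
          then show "y \<in> frontier A" using circ s circle_pt_in_sphere by blast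
        qed
      qed (use pq t common V(4) W(4) in auto)
      have "pi + 2 \<le> \<tau> + 2 * sin (\<tau> / 2)"
        using True t by (intro add_twice_sin_half_ge) (auto simp: \<tau>_def)
      then have "ennreal (pi + 2) \<le> perimeter A"
        unfolding perimeter_def using ge[unfolded eq] by (rule order_trans[OF ennreal_leI])
      then show ?thesis by (simp add: max.coboundedI1)
    next
      case False
      define \<sigma> where "\<sigma> = 2 * pi - \<tau>"
      have eq: "(\<theta> + (t1 + 2 * pi)) - (\<theta> + t2) = \<sigma>" by (simp add: \<sigma>_def \<tau>_def)
      have ge: "ennreal ((\<theta> + (t1 + 2 * pi)) - (\<theta> + t2) + 2 * sin (((\<theta> + (t1 + 2 * pi)) - (\<theta> + t2)) / 2)) \<le> hausdorff1 (frontier B)"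
      proof (rule hausdorff1_arc_and_common_boundary_ge[OF V(2) W(2) V(3) W(3) cover])
        show "circle_pt c ` {\<theta> + t2..\<theta> + (t1 + 2 * pi)} \<subseteq> frontier B"
        proof
          fix y assume "y \<in> circle_pt c ` {\<theta> + t2..\<theta> + (t1 + 2 * pi)}"
          then obtain s where s: "\<theta> + t2 \<le> s" "s \<le> \<theta> + (t1 + 2 * pi)" "y = circle_pt c s" by auto
          have "?g (s - \<theta>) \<in> ?L"
          \<comment> \<open>The complementary arc passes the base point at angle
            \<open>2 * pi\<close>. Up to there it is covered by \<open>L2\<close>, and beyond, after
            subtracting a full turn, by \<open>L1\<close>.\<close>
          proof (cases "s - \<theta> \<le> 2 * pi")
            case True
            then show ?thesis using s by (intro subsetD[OF L2] imageI) auto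
          next
            case False
            then have "?g (s - \<theta> - 2 * pi) \<in> ?L" using s by (intro subsetD[OF L1] imageI) auto
            then show ?thesis using per[of "s - \<theta> - 2 * pi"] by simp
          qed
          then show "y \<in> frontier B" using circ s circle_pt_in_sphere by auto
        qed
        show "circle_pt c (\<theta> + (t1 + 2 * pi)) \<in> closure V \<inter> closure W"
          using per[of t1] pq V(4) W(4) by simp
      qed (use pq t lt common V(4) W(4) in auto)
      have "pi + 2 \<le> \<sigma> + 2 * sin (\<sigma> / 2)"
        using False lt by (intro add_twice_sin_half_ge) (auto simp: \<tau>_def \<sigma>_def)
      then have "ennreal (pi + 2) \<le> perimeter B"
        unfolding perimeter_def using ge[unfolded eq] by (rule order_trans[OF ennreal_leI])
      then show ?thesis by (simp add: max.coboundedI2)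
    qed
  qed
qed

section \<open>Integrals over circular caps\<close>

lemma Basis_real2: "(Basis :: (real^2) set) = {axis 1 1, axis 2 1}"
  by (auto simp: Basis_vec_def UNIV_2)

text \<open>Lebesgue measure is determined by its values on boxes. The identification carries
  Fubini's theorem from \<open>real \<times> real\<close> over to \<open>real^2\<close>.\<close>

lemma distr_lborel_pair:
  "distr (lborel :: (real \<times> real) measure) borel (\<lambda>(a, b). a *\<^sub>R axis 1 1 + b *\<^sub>R axis 2 1 :: real^2) = lborel"
proof (rule lborel_eqI[symmetric])
  fix l u :: "real^2"
  assume le: "\<And>b. b \<in> Basis \<Longrightarrow> l \<bullet> b \<le> u \<bullet> b"
  let ?P = "\<lambda>(a, b). a *\<^sub>R axis 1 1 + b *\<^sub>R axis 2 1 :: real^2"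
  have le': "l $ 1 \<le> u $ 1" "l $ 2 \<le> u $ 2"
    using le[of "axis 1 1"] le[of "axis 2 1"] by (auto simp: Basis_real2 inner_axis)
  have P[measurable]: "?P \<in> borel_measurable lborel"
    by (simp add: borel_measurable_continuous_onI case_prod_unfold continuous_intros)
  have vimage: "?P -` box l u = {l $ 1<..<u $ 1} \<times> {l $ 2<..<u $ 2}"
    by (auto simp: mem_box_cart forall_2 axis_def)
  have "emeasure (distr lborel borel ?P) (box l u) = emeasure (lborel \<Otimes>\<^sub>M lborel) ({l $ 1<..<u $ 1} \<times> {l $ 2<..<u $ 2})"
    by (subst emeasure_distr) (auto simp: vimage lborel_prod)
  also have "\<dots> = ennreal (u $ 1 - l $ 1) * ennreal (u $ 2 - l $ 2)"
    using le' by (subst lborel.emeasure_pair_measure_Times) auto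
  also have "\<dots> = ennreal ((u $ 1 - l $ 1) * (u $ 2 - l $ 2))"
    using le' by (simp add: ennreal_mult)
  also have "(u $ 1 - l $ 1) * (u $ 2 - l $ 2) = (\<Prod>b\<in>Basis. (u - l) \<bullet> b)"
    by (simp add: Basis_real2 inner_axis axis_eq_axis)
  finally show "emeasure (distr lborel borel ?P) (box l u) = ennreal (\<Prod>b\<in>Basis. (u - l) \<bullet> b)" .
qed simp

text \<open>The preimage of a box is its image under the inverse transformation, which has the same
  measure. Any unit vector can thus take the role of the first axis.\<close>

lemma distr_lborel_orthogonal_transformation:
  fixes f :: "real^'n::{finite,wellorder} \<Rightarrow> real^'n::_"
  assumes f: "orthogonal_transformation f"
  shows "distr lborel borel f = lborel"
proof (rule lborel_eqI[symmetric])
  fix l u :: "real^'n::_"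
  assume le: "\<And>b. b \<in> Basis \<Longrightarrow> l \<bullet> b \<le> u \<bullet> b"
  have lin: "linear f" using f by (rule orthogonal_transformation_linear)
  have [measurable]: "f \<in> borel_measurable borel"
    using lin by (intro borel_measurable_continuous_onI linear_continuous_on) (simp add: linear_conv_bounded_linear)
  have bij: "bij f" using f by (rule orthogonal_transformation_bij)
  have inv: "orthogonal_transformation (inv f)" using f by (rule orthogonal_transformation_inv)
  have vimage: "f -` box l u = inv f ` box l u" using bij by (rule bij_vimage_eq_inv_image)
  have fin: "inv f ` box l u \<in> lmeasurable"
    using inv by (rule measurable_orthogonal_image) auto
  have "f -` box l u \<in> sets borel"
    using measurable_sets[of f borel borel "box l u"] by simp
  then have "emeasure (distr lborel borel f) (box l u) = emeasure lebesgue (inv f ` box l u)"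
    by (subst emeasure_distr) (auto simp: vimage[symmetric])
  also have "\<dots> = ennreal (measure lebesgue (inv f ` box l u))"
    using fin by (intro emeasure_eq_measure2) (auto simp: fmeasurable_def)
  also have "\<dots> = ennreal (measure lebesgue (box l u))"
    using measure_orthogonal_image[OF inv, of "box l u"] by simp
  also have "\<dots> = ennreal (\<Prod>b\<in>Basis. (u - l) \<bullet> b)"
    using le by (simp add: measure_def emeasure_lborel_box prod_nonneg inner_diff_left)
  finally show "emeasure (distr lborel borel f) (box l u) = ennreal (\<Prod>b\<in>Basis. (u - l) \<bullet> b)" .
qed simp

text \<open>Fubini in coordinates along and across \<open>u\<close>: the slice at height
  \<open>a\<close> is a chord of length \<open>2 * sqrt (1 - a\<^sup>2)\<close>.\<close>

lemma integral_disk_slices: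
  fixes u c :: "real^2" and \<phi> :: "real \<Rightarrow> real"
  assumes u: "norm u = 1" and \<phi>: "\<phi> \<in> borel_measurable borel"
    and bdd: "\<And>a. \<bar>\<phi> a\<bar> \<le> C"
  shows "(LINT x:cball c 1|lebesgue. \<phi> (u \<bullet> (x - c)))
    = (LINT a|lborel. \<phi> a * (2 * sqrt (1 - a\<^sup>2)) * indicator {-1..1} a)"
proof -
  let ?P = "\<lambda>(a, b). a *\<^sub>R axis 1 1 + b *\<^sub>R axis 2 1 :: real^2"
  obtain f :: "real^2 \<Rightarrow> real^2" where f: "orthogonal_transformation f" "f (axis 1 1) = u"
    using orthogonal_transformation_exists_1[of "axis 1 1" u] u by (auto simp: norm_axis_1)
  have lin: "linear f" using f(1) by (rule orthogonal_transformation_linear)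
  have [measurable]: "f \<in> borel_measurable borel"
    using lin by (intro borel_measurable_continuous_onI linear_continuous_on) (simp add: linear_conv_bounded_linear)
  have P[measurable]: "?P \<in> borel_measurable borel"
    by (simp add: borel_measurable_continuous_onI case_prod_unfold continuous_intros)
  \<comment> \<open>Coordinates centred at \<open>c\<close> with first axis \<open>u\<close>. The
    map preserves Lebesgue measure, as a composition of the identification of the planes, an
    orthogonal map and a translation.\<close>
  let ?T = "\<lambda>p. c + f (?P p)"
  have fP: "(\<lambda>p. f (?P p)) \<in> borel_measurable borel"
    by (rule measurable_compose[OF P]) measurable
  then have T_meas: "?T \<in> borel_measurable borel" by (intro borel_measurable_add) auto
  have "distr (lborel :: (real \<times> real) measure) borel ?T = distr (distr (distr lborel borel ?P) borel f) borel ((+) c)"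
    by (subst distr_distr, simp, simp, subst distr_distr) (use P fP in \<open>auto simp: o_def\<close>)
  then have T: "distr (lborel :: (real \<times> real) measure) borel ?T = lborel"
    by (simp add: distr_lborel_pair distr_lborel_orthogonal_transformation[OF f(1)] lborel_distr_plus)
  define g where "g = (\<lambda>x. indicator (cball c 1) x * \<phi> (u \<bullet> (x - c)))"
  have "(\<lambda>x. \<phi> (u \<bullet> (x - c))) \<in> borel_measurable borel"
    by (rule measurable_compose[OF _ \<phi>]) (intro borel_measurable_continuous_onI continuous_intros)
  then have g_meas: "g \<in> borel_measurable borel"
    unfolding g_def by (intro borel_measurable_times borel_measurable_indicator) auto
  define h where "h = (\<lambda>(a, b). (indicator {p. (fst p)\<^sup>2 + (snd p)\<^sup>2 \<le> 1} (a, b) :: real) * \<phi> a)"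
  have gh: "g (?T p) = h p" for p :: "real \<times> real"
  proof -
    obtain a b where p: "p = (a, b)" by force
    have "u \<bullet> f (?P p) = axis 1 1 \<bullet> ?P p"
      using f unfolding orthogonal_transformation_def by metis
    also have "\<dots> = a" by (simp add: p inner_add_right inner_axis_axis)
    finally have ip: "u \<bullet> f (?P p) = a" .
    have "norm (f (?P p)) = norm (?P p)" using f(1) by (rule orthogonal_transformation_norm)
    also have "(norm (?P p))\<^sup>2 = a\<^sup>2 + b\<^sup>2"
      unfolding power2_norm_eq_inner by (simp add: inner_vec_def sum_2 p axis_def power2_eq_square)
    finally have "norm (f (?P p)) \<le> 1 \<longleftrightarrow> a\<^sup>2 + b\<^sup>2 \<le> 1"
      by (metis abs_norm_cancel abs_square_le_1)
    then show ?thesis unfolding g_def h_def using ip by (simp add: p indicator_def dist_norm)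
  qed
  have closed: "closed {p :: real \<times> real. (fst p)\<^sup>2 + (snd p)\<^sup>2 \<le> 1}"
    by (intro closed_Collect_le continuous_intros)
  have "(\<lambda>p :: real \<times> real. \<phi> (fst p)) \<in> borel_measurable borel"
    by (rule measurable_compose[OF _ \<phi>]) (intro borel_measurable_continuous_onI continuous_intros)
  then have h_meas: "h \<in> borel_measurable borel"
    unfolding h_def case_prod_unfold prod.collapse using closed
    by (intro borel_measurable_times borel_measurable_indicator) auto
  have int: "integrable (lborel \<Otimes>\<^sub>M lborel) h"
    unfolding lborel_prod
  proof (rule Bochner_Integration.integrable_bound)
    show "integrable lborel (\<lambda>p. C * indicator (cbox (-1, -1) (1, 1)) p :: real)"
      by (intro integrable_mult_right integrable_real_indicator) (auto simp: emeasure_lborel_cbox_eq)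
    show "h \<in> borel_measurable lborel" using h_meas by simp
    have "norm (h p) \<le> norm (C * indicator (cbox (-1, -1) (1, 1)) p :: real)" for p
    proof (cases "(fst p)\<^sup>2 + (snd p)\<^sup>2 \<le> 1")
      case True
      then have "(fst p)\<^sup>2 \<le> 1" "(snd p)\<^sup>2 \<le> 1"
        using zero_le_power2[of "fst p"] zero_le_power2[of "snd p"] by linarith+
      then have "\<bar>fst p\<bar> \<le> 1" "\<bar>snd p\<bar> \<le> 1" by (auto simp: abs_square_le_1)
      then have "p \<in> cbox (-1, -1) (1, 1)" by (cases p) (auto simp: cbox_Pair_eq)
      then show ?thesis using True bdd[of "fst p"] by (auto simp: h_def case_prod_unfold)
    qed (auto simp: h_def case_prod_unfold)
    then show "AE p in lborel. norm (h p) \<le> norm (C * indicator (cbox (-1, -1) (1, 1)) p :: real)" by simp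
  qed
  have inner: "(LINT b|lborel. h (a, b)) = \<phi> a * (2 * sqrt (1 - a\<^sup>2)) * indicator {-1..1} a" for a
  proof (cases "a \<in> {-1..1}")
    case True
    then have "a\<^sup>2 \<le> 1" by (auto simp: abs_square_le_1)
    have "b\<^sup>2 \<le> 1 - a\<^sup>2 \<longleftrightarrow> \<bar>b\<bar> \<le> sqrt (1 - a\<^sup>2)" for b
      by (metis real_sqrt_abs real_sqrt_le_iff)
    then have "h (a, b) = \<phi> a * indicator {- sqrt (1 - a\<^sup>2)..sqrt (1 - a\<^sup>2)} b" for b
      by (auto simp: h_def indicator_def algebra_simps abs_le_iff)
    then show ?thesis using True \<open>a\<^sup>2 \<le> 1\<close> by simp
  next
    case False
    then have "\<not> a\<^sup>2 + b\<^sup>2 \<le> 1" for b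
      using abs_square_le_1[of a] zero_le_power2[of b] by (smt (verit) atLeastAtMost_iff)
    then show ?thesis using False by (simp add: h_def)
  qed
  have "(LINT x:cball c 1|lebesgue. \<phi> (u \<bullet> (x - c))) = integral\<^sup>L lebesgue g"
    by (simp add: set_lebesgue_integral_def g_def)
  also have "\<dots> = integral\<^sup>L lborel g" by (rule integral_completion) (simp add: g_meas)
  also have "\<dots> = integral\<^sup>L (distr (lborel :: (real \<times> real) measure) borel ?T) g" by (simp only: T)
  also have "\<dots> = (LINT p|(lborel :: (real \<times> real) measure). g (?T p))"
    by (subst integral_distr) (use T_meas g_meas in simp_all)
  also have "\<dots> = integral\<^sup>L (lborel \<Otimes>\<^sub>M lborel) h" by (simp only: gh lborel_prod)
  also have "\<dots> = (LINT a|lborel. LINT b|lborel. h (a, b))"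
    using lborel_pair.integral_fst'[OF int] by simp
  finally show ?thesis by (simp only: inner)
qed

text \<open>The fundamental theorem of calculus, applied to the slices. The derivative is required
  only in the open interval because the square roots and arcsines in the antiderivatives used later
  are not differentiable at its ends.\<close>

lemma integral_cap:
  fixes u c :: "real^2" and \<psi> F :: "real \<Rightarrow> real"
  assumes u: "norm u = 1" and s: "-1 \<le> s" "s \<le> 1"
    and cont: "continuous_on {-1..1} \<psi>" "continuous_on {-1..1} F"
    and deriv: "\<And>a. -1 < a \<Longrightarrow> a < 1 \<Longrightarrow> (F has_real_derivative \<psi> a * (2 * sqrt (1 - a\<^sup>2))) (at a)"
  shows "(LINT x:{x \<in> cball c 1. s \<le> u \<bullet> (x - c)}|lebesgue. \<psi> (u \<bullet> (x - c))) = F 1 - F s"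
proof -
  have sub: "{s..1} \<subseteq> {-1..1}" using s by auto
  have cs: "continuous_on {s..1} \<psi>" "continuous_on {s..1} F"
    using cont sub continuous_on_subset by blast+
  \<comment> \<open>Cutting \<open>\<psi>\<close> off outside \<open>{s..1}\<close> restricts to the
    cap and also yields a bounded Borel function on the whole line, as slicing requires.\<close>
  define \<phi> where "\<phi> = (\<lambda>a. indicator {s..1} a *\<^sub>R \<psi> a)"
  have meas: "\<phi> \<in> borel_measurable borel"
    unfolding \<phi>_def using cs(1) by (intro borel_measurable_continuous_on_indicator) auto
  have "bounded (\<psi> ` {s..1})"
    using cs(1) by (intro compact_imp_bounded compact_continuous_image) auto
  then obtain C where C: "\<forall>a\<in>{s..1}. \<bar>\<psi> a\<bar> \<le> C" by (auto simp: bounded_iff)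
  then have "0 \<le> C" using s by (meson abs_ge_zero atLeastAtMost_iff order_refl order_trans)
  then have bdd: "\<bar>\<phi> a\<bar> \<le> C" for a using C by (auto simp: \<phi>_def indicator_def)
  have u_le: "u \<bullet> (x - c) \<le> 1" if "x \<in> cball c 1" for x
    using norm_cauchy_schwarz[of u "x - c"] u that by (simp add: dist_norm norm_minus_commute)
  have "(LINT x:{x \<in> cball c 1. s \<le> u \<bullet> (x - c)}|lebesgue. \<psi> (u \<bullet> (x - c)))
      = (LINT x:cball c 1|lebesgue. \<phi> (u \<bullet> (x - c)))"
    unfolding set_lebesgue_integral_def \<phi>_def
    using u_le by (intro Bochner_Integration.integral_cong) (auto simp: indicator_def)
  also have "\<dots> = (LINT a|lborel. \<phi> a * (2 * sqrt (1 - a\<^sup>2)) * indicator {-1..1} a)"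
    by (rule integral_disk_slices[OF u meas bdd])
  also have "\<dots> = (LINT a:{s..1}|lborel. \<psi> a * (2 * sqrt (1 - a\<^sup>2)))"
    unfolding set_lebesgue_integral_def \<phi>_def using s
    by (intro Bochner_Integration.integral_cong) (auto simp: indicator_def)
  also have "\<dots> = integral {s..1} (\<lambda>a. \<psi> a * (2 * sqrt (1 - a\<^sup>2)))"
    using cs by (intro set_borel_integral_eq_integral borel_integrable_atLeastAtMost' continuous_intros)
  also have "\<dots> = F 1 - F s"
    using s cs deriv
    by (intro integral_unique fundamental_theorem_of_calculus_interior)
       (auto simp: has_real_derivative_iff_has_vector_derivative[symmetric])
  finally show ?thesis .
qed

lemma has_real_derivative_sqrt_one_minus_square:
  "-1 < a \<Longrightarrow> a < 1 \<Longrightarrow> ((\<lambda>a. sqrt (1 - a\<^sup>2)) has_real_derivative - a / sqrt (1 - a\<^sup>2)) (at a)"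
proof -
  assume a: "-1 < a" "a < 1"
  then have "a\<^sup>2 < 1" by (simp add: abs_square_less_1)
  then show ?thesis
    by (auto intro!: derivative_eq_intros simp: field_simps)
qed

text \<open>Writing the threshold as \<open>sin t\<close> turns the half chord
  \<open>sqrt (1 - (sin t)\<^sup>2)\<close> into \<open>cos t\<close>. Each integral comes from an
  explicit antiderivative.\<close>

lemma disk_cap_integrals:
  fixes u c :: "real^2"
  assumes u: "norm u = 1" and t: "- (pi / 2) \<le> t" "t \<le> pi / 2"
  defines "cap \<equiv> {x \<in> cball c 1. sin t \<le> u \<bullet> (x - c)}"
  shows area_cap: "measure lebesgue cap = pi / 2 - t - sin t * cos t"
    and first_moment_cap: "(LINT x:cap|lebesgue. u \<bullet> (x - c)) = 2 / 3 * cos t ^ 3"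
    and second_moment_disk: "(LINT x:cball c 1|lebesgue. (u \<bullet> (x - c))\<^sup>2) = pi / 4"
proof -
  have cos0: "0 \<le> cos t" using t by (intro cos_ge_zero) auto
  have sq: "sqrt (1 - (sin t)\<^sup>2) = cos t"
    using cos0 by (simp add: cos_squared_eq[symmetric])
  have sq_deriv: "(sqrt (1 - a\<^sup>2))\<^sup>2 = 1 - a\<^sup>2" "0 < sqrt (1 - a\<^sup>2)" if "-1 < a" "a < 1" for a :: real
    using that abs_square_less_1[of a] by (auto simp: abs_less_iff)
  have "measure lebesgue cap = (LINT x:cap|lebesgue. 1)"
    by (simp add: set_lebesgue_integral_def)
  also have "\<dots> = (1 * sqrt (1 - 1\<^sup>2) + arcsin 1) - (sin t * sqrt (1 - (sin t)\<^sup>2) + arcsin (sin t))"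
    unfolding cap_def
  proof (rule integral_cap[OF u])
    fix a :: real assume a: "-1 < a" "a < 1"
    note sq = sq_deriv[OF a]
    show "((\<lambda>a. a * sqrt (1 - a\<^sup>2) + arcsin a) has_real_derivative 1 * (2 * sqrt (1 - a\<^sup>2))) (at a)"
      using sq a by (auto intro!: derivative_eq_intros has_real_derivative_sqrt_one_minus_square
        simp: field_simps power2_eq_square[symmetric])
  qed (auto intro!: continuous_intros)
  also have "\<dots> = pi / 2 - t - sin t * cos t" using t sq by (simp add: arcsin_sin)
  finally show "measure lebesgue cap = pi / 2 - t - sin t * cos t" .
  have "(LINT x:cap|lebesgue. u \<bullet> (x - c))
      = - (2 / 3) * ((1 - 1\<^sup>2) * sqrt (1 - 1\<^sup>2)) - - (2 / 3) * ((1 - (sin t)\<^sup>2) * sqrt (1 - (sin t)\<^sup>2))"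
    unfolding cap_def
  proof (rule integral_cap[OF u])
    fix a :: real assume a: "-1 < a" "a < 1"
    note sq = sq_deriv[OF a]
    show "((\<lambda>a. - (2 / 3) * ((1 - a\<^sup>2) * sqrt (1 - a\<^sup>2))) has_real_derivative a * (2 * sqrt (1 - a\<^sup>2))) (at a)"
      using sq a by (auto intro!: derivative_eq_intros has_real_derivative_sqrt_one_minus_square
        simp: field_simps power2_eq_square[symmetric])
  qed (auto intro!: continuous_intros)
  also have "\<dots> = 2 / 3 * ((cos t)\<^sup>2 * cos t)"
    using cos0 by (simp add: sq cos_squared_eq[symmetric])
  also have "\<dots> = 2 / 3 * cos t ^ 3"
    by (simp add: power2_eq_square power3_eq_cube)
  finally show "(LINT x:cap|lebesgue. u \<bullet> (x - c)) = 2 / 3 * cos t ^ 3" .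
  have "- 1 \<le> u \<bullet> (x - c)" if "x \<in> cball c 1" for x
    using norm_cauchy_schwarz[of "-u" "x - c"] u that by (simp add: dist_norm norm_minus_commute)
  then have "cball c 1 = {x \<in> cball c 1. - 1 \<le> u \<bullet> (x - c)}" by auto
  then have "(LINT x:cball c 1|lebesgue. (u \<bullet> (x - c))\<^sup>2)
    = (LINT x:{x \<in> cball c 1. - 1 \<le> u \<bullet> (x - c)}|lebesgue. (u \<bullet> (x - c))\<^sup>2)" by simp
  \<comment> \<open>The whole disk is the cap with threshold -1. Substituting
    \<open>a = sin x\<close> turns the integrand into \<open>(sin (2 * x))\<^sup>2 / 2\<close>,
    whose antiderivative \<open>(x - sin (4 * x) / 4) / 4\<close> is here rewritten in
    \<open>a\<close>.\<close>
  also have "\<dots> = (arcsin 1 - 1 * (1 - 2 * 1\<^sup>2) * sqrt (1 - 1\<^sup>2)) / 4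
      - (arcsin (-1) - (-1) * (1 - 2 * (-1)\<^sup>2) * sqrt (1 - (-1)\<^sup>2)) / 4"
  proof (rule integral_cap[OF u])
    fix a :: real assume a: "-1 < a" "a < 1"
    note sq = sq_deriv[OF a]
    define S where "S = sqrt (1 - a\<^sup>2)"
    have S: "0 < S" "S\<^sup>2 = 1 - a\<^sup>2" using sq by (auto simp: S_def)
    have "(inverse S - ((1 - 6 * a\<^sup>2) * S + (- a / S) * (a * (1 - 2 * a\<^sup>2)))) / 4
        = (1 - (1 - 6 * a\<^sup>2) * S\<^sup>2 + a\<^sup>2 * (1 - 2 * a\<^sup>2)) / (4 * S)"
      using S(1) by (simp add: field_simps power2_eq_square)
    also have "1 - (1 - 6 * a\<^sup>2) * S\<^sup>2 + a\<^sup>2 * (1 - 2 * a\<^sup>2) = 8 * a\<^sup>2 * S\<^sup>2"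
      unfolding S(2) by (simp add: algebra_simps power2_eq_square)
    also have "8 * a\<^sup>2 * S\<^sup>2 / (4 * S) = a\<^sup>2 * (2 * S)"
      using S(1) by (simp add: power2_eq_square)
    finally have eq: "(inverse S - ((1 - 6 * a\<^sup>2) * S + (- a / S) * (a * (1 - 2 * a\<^sup>2)))) / 4 = a\<^sup>2 * (2 * S)" .
    have "((\<lambda>a. a * (1 - 2 * a\<^sup>2)) has_real_derivative 1 - 6 * a\<^sup>2) (at a)"
      by (auto intro!: derivative_eq_intros simp: power2_eq_square)
    then have "((\<lambda>a. (arcsin a - a * (1 - 2 * a\<^sup>2) * sqrt (1 - a\<^sup>2)) / 4) has_real_derivative
        (inverse S - ((1 - 6 * a\<^sup>2) * S + (- a / S) * (a * (1 - 2 * a\<^sup>2)))) / 4) (at a)"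
      unfolding S_def
      by (intro DERIV_cdivide DERIV_diff DERIV_mult DERIV_arcsin has_real_derivative_sqrt_one_minus_square a)
    then show "((\<lambda>a. (arcsin a - a * (1 - 2 * a\<^sup>2) * sqrt (1 - a\<^sup>2)) / 4) has_real_derivative
        a\<^sup>2 * (2 * sqrt (1 - a\<^sup>2))) (at a)"
      unfolding eq by (simp only: S_def)
  qed (auto intro!: continuous_intros)
  also have "\<dots> = pi / 4" by simp
  finally show "(LINT x:cball c 1|lebesgue. (u \<bullet> (x - c))\<^sup>2) = pi / 4" .
qed

section \<open>Moments of inertia\<close>

lemma set_integrable_disk_subset:
  fixes f :: "'a::euclidean_space \<Rightarrow> 'b::euclidean_space"
  assumes "A \<in> sets lebesgue" "A \<subseteq> cball c 1" "continuous_on (cball c 1) f"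
  shows "set_integrable lebesgue A f"
proof -
  have "integrable lborel (\<lambda>x. indicator (cball c 1) x *\<^sub>R f x)"
    using assms(3) by (intro borel_integrable_compact) auto
  then have "set_integrable lebesgue (cball c 1) f"
    unfolding set_integrable_def by (simp add: integrable_completion borel_measurable_integrable)
  then show ?thesis using assms(1,2) by (rule set_integrable_subset)
qed

lemma inner_first_moment:
  fixes c u :: "'a::euclidean_space"
  assumes "A \<in> sets lebesgue" "A \<subseteq> cball c 1"
  shows "u \<bullet> (LINT x:A|lebesgue. x - c) = (LINT x:A|lebesgue. u \<bullet> (x - c))"
proof -
  have "set_integrable lebesgue A (\<lambda>x. x - c)"
    using assms by (intro set_integrable_disk_subset continuous_intros)
  then show ?thesis
    unfolding set_integrable_def set_lebesgue_integral_def
    by (subst integral_inner_right[symmetric]) auto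
qed

lemma set_integral_of_measure_zero:
  fixes f :: "'a::euclidean_space \<Rightarrow> 'b::{banach, second_countable_topology}"
  assumes "A \<in> lmeasurable" "measure lebesgue A = 0"
  shows "(LINT x:A|lebesgue. f x) = 0"
proof -
  have "emeasure lebesgue A = 0"
    using assms by (simp add: emeasure_eq_measure2)
  then have "A \<in> null_sets lebesgue" using assms by auto
  then have "AE x in lebesgue. x \<notin> A" by (rule AE_not_in)
  then show ?thesis
    unfolding set_lebesgue_integral_def by (intro integral_eq_zero_AE) (auto elim!: eventually_mono)
qed

lemma set_integral_const_lmeasurable:
  fixes k :: "'b::{banach, second_countable_topology}"
  shows "A \<in> lmeasurable \<Longrightarrow> (LINT x:A|lebesgue. k) = measure lebesgue A *\<^sub>R k"
  unfolding set_lebesgue_integral_def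
  by (subst integral_scaleR_left) (auto simp: fmeasurable_def)

lemma disk_subset_lmeasurable:
  "A \<in> sets lebesgue \<Longrightarrow> A \<subseteq> cball c r \<Longrightarrow> A \<in> lmeasurable" for c :: "'a::euclidean_space"
  using bounded_cball bounded_set_imp_lmeasurable bounded_subset by blast

text \<open>Bathtub principle: within the disk, \<open>u \<bullet> (x - c) - sin t\<close> is nonnegative exactly on the cap
  whose area is that of \<open>A\<close>.\<close>

lemma first_moment_le_cap:
  fixes u c :: "real^2"
  assumes u: "norm u = 1" and t: "- (pi / 2) \<le> t" "t \<le> pi / 2"
    and A: "A \<in> sets lebesgue" "A \<subseteq> cball c 1"
    and area: "measure lebesgue A = pi / 2 - t - sin t * cos t"
  shows "(LINT x:A|lebesgue. u \<bullet> (x - c)) \<le> 2 / 3 * cos t ^ 3"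
proof -
  define cap where "cap = {x \<in> cball c 1. sin t \<le> u \<bullet> (x - c)}"
  have "closed {x. sin t \<le> u \<bullet> (x - c)}" by (intro closed_Collect_le continuous_intros)
  moreover have "cap = cball c 1 \<inter> {x. sin t \<le> u \<bullet> (x - c)}" by (auto simp: cap_def)
  ultimately have "closed cap" by auto
  then have cap: "cap \<in> sets lebesgue" "cap \<subseteq> cball c 1" by (auto simp: cap_def)
  let ?f = "\<lambda>x. u \<bullet> (x - c)"
  have shift: "(LINT x:X|lebesgue. ?f x - sin t) = (LINT x:X|lebesgue. ?f x) - measure lebesgue X * sin t"
    and int: "set_integrable lebesgue X (\<lambda>x. ?f x - sin t)"
    if X: "X \<in> sets lebesgue" "X \<subseteq> cball c 1" for X
  proof -
    have "set_integrable lebesgue X ?f" "set_integrable lebesgue X (\<lambda>x. sin t)"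
      using X by (auto intro!: set_integrable_disk_subset continuous_intros)
    then have "(LINT x:X|lebesgue. ?f x - sin t) = (LINT x:X|lebesgue. ?f x) - (LINT x:X|lebesgue. sin t)"
      by (rule set_integral_diff)
    also have "(LINT x:X|lebesgue. sin t) = measure lebesgue X * sin t"
      by (simp add: set_integral_const_lmeasurable[OF disk_subset_lmeasurable[OF X]])
    finally show "(LINT x:X|lebesgue. ?f x - sin t) = (LINT x:X|lebesgue. ?f x) - measure lebesgue X * sin t" .
    show "set_integrable lebesgue X (\<lambda>x. ?f x - sin t)"
      using X by (intro set_integrable_disk_subset continuous_intros)
  qed
  have "(LINT x:A|lebesgue. ?f x - sin t) \<le> (LINT x:cap|lebesgue. ?f x - sin t)"
    unfolding set_lebesgue_integral_def
  proof (rule integral_mono)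
    show "integrable lebesgue (\<lambda>x. indicator A x *\<^sub>R (?f x - sin t))"
      "integrable lebesgue (\<lambda>x. indicator cap x *\<^sub>R (?f x - sin t))"
      using int[OF A] int[OF cap] by (auto simp: set_integrable_def)
    show "indicator A x *\<^sub>R (?f x - sin t) \<le> indicator cap x *\<^sub>R (?f x - sin t)" for x
      using A(2) by (auto simp: cap_def indicator_def)
  qed
  moreover have "measure lebesgue cap = measure lebesgue A"
    unfolding cap_def area using area_cap[OF u t, of c] .
  ultimately have "(LINT x:A|lebesgue. ?f x) \<le> (LINT x:cap|lebesgue. ?f x)"
    by (simp add: shift[OF A] shift[OF cap])
  then show ?thesis
    unfolding cap_def using first_moment_cap[OF u t, of c] by simp
qed

text \<open>Both sides agree at 0 and at \<open>pi / 2\<close>. Up to the factor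
  \<open>(cos t)\<^sup>2\<close>, the difference \<open>f\<close> has derivative \<open>h\<close>
  and \<open>h\<close> has derivative \<open>k\<close>, where \<open>k\<close> decreases through
  zero. So \<open>h\<close> rises from 0 and then falls to a negative value, and \<open>f\<close>
  rises from 0 and then falls back to 0.\<close>

lemma cap_trig_inequality_nonneg:
  assumes "0 \<le> t" "t \<le> pi / 2"
  shows "4 * (t + sin t * cos t)\<^sup>2 \<le> pi\<^sup>2 * (1 - cos t ^ 6)"
proof -
  define f where "f = (\<lambda>t. pi\<^sup>2 * (1 - cos t ^ 6) - 4 * (t + sin t * cos t)\<^sup>2)"
  define h where "h = (\<lambda>t. 6 * pi\<^sup>2 * (cos t ^ 3 * sin t) - 16 * (t + sin t * cos t))"
  define k where "k = (\<lambda>t. 6 * pi\<^sup>2 * (4 * (cos t)\<^sup>2 - 3) - 32 :: real)"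
  have f': "(f has_real_derivative (cos t)\<^sup>2 * h t) (at t)" for t
  proof -
    define w where "w = (\<lambda>t::real. t + sin t * cos t)"
    have "(w has_real_derivative 1 + (cos t * cos t - sin t * sin t)) (at t)"
      unfolding w_def
      by (auto intro!: derivative_eq_intros)
    moreover have "1 + (cos t * cos t - sin t * sin t) = 2 * (cos t)\<^sup>2"
      using sin_cos_squared_add[of t] by (simp add: power2_eq_square)
    ultimately have w': "(w has_real_derivative 2 * (cos t)\<^sup>2) (at t)" by simp
    have "((\<lambda>t. pi\<^sup>2 * (1 - cos t ^ 6) - 4 * (w t)\<^sup>2) has_real_derivative
        (cos t)\<^sup>2 * (6 * pi\<^sup>2 * (cos t ^ 3 * sin t) - 16 * w t)) (at t)"
      by (auto intro!: derivative_eq_intros w' simp: algebra_simps eval_nat_numeral)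
    then show ?thesis by (simp only: f_def h_def w_def)
  qed
  have h': "(h has_real_derivative (cos t)\<^sup>2 * k t) (at t)" for t
  proof -
    have s: "sin t * sin t = 1 - cos t * cos t"
      using sin_cos_squared_add[of t] by (simp add: power2_eq_square algebra_simps)
    have "(h has_real_derivative 6 * pi\<^sup>2 * (cos t ^ 4 - 3 * (cos t)\<^sup>2 * (sin t * sin t))
        - 16 * (1 + (cos t * cos t - sin t * sin t))) (at t)"
      unfolding h_def by (auto intro!: derivative_eq_intros simp: algebra_simps eval_nat_numeral)
    moreover have "6 * pi\<^sup>2 * (cos t ^ 4 - 3 * (cos t)\<^sup>2 * (sin t * sin t))
        - 16 * (1 + (cos t * cos t - sin t * sin t)) = (cos t)\<^sup>2 * k t"
      unfolding s k_def by (simp add: algebra_simps eval_nat_numeral)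
    ultimately show ?thesis by simp
  qed
  have k_mono: "k t \<le> k s" if "0 \<le> s" "s \<le> t" "t \<le> pi / 2" for s t
  proof -
    have "cos t \<le> cos s" using that pi_gt_zero by (intro cos_monotone_0_pi_le) linarith+
    moreover have "0 \<le> cos t" using that by (intro cos_ge_zero) auto
    ultimately have "(cos t)\<^sup>2 \<le> (cos s)\<^sup>2" by (intro power_mono)
    then show ?thesis unfolding k_def by simp
  qed
  have pi9: "9 < pi\<^sup>2" using power_strict_mono[of 3 pi 2] pi_gt3 by simp
  have contk: "continuous_on X k" for X unfolding k_def by (intro continuous_intros)
  \<comment> \<open>\<open>k 0 = 6 * pi\<^sup>2 - 32\<close> is positive because
    \<open>pi\<^sup>2 > 9\<close>, and \<open>k (pi / 2)\<close> is negative.\<close>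
  obtain z where z: "0 \<le> z" "z \<le> pi / 2" "k z = 0"
    using IVT2'[of k "pi / 2" 0 0, OF _ _ _ contk] pi9 by (auto simp: k_def)
  have h_up: "0 \<le> h s" if "0 \<le> s" "s \<le> z" for s
  proof -
    have "h 0 \<le> h s"
    proof (rule DERIV_nonneg_imp_nondecreasing[OF that(1)])
      fix x assume "0 \<le> x" "x \<le> s"
      then have "0 \<le> k x" using k_mono[of x z] z that by simp
      then show "\<exists>y. (h has_real_derivative y) (at x) \<and> 0 \<le> y" using h'[of x] by (intro exI[of _ "(cos x)\<^sup>2 * k x"]) simp
    qed
    then show ?thesis by (simp add: h_def)
  qed
  have h_down: "h t \<le> h s" if "z \<le> s" "s \<le> t" "t \<le> pi / 2" for s t
  proof (rule DERIV_nonpos_imp_nonincreasing[OF that(2)])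
    fix x assume "s \<le> x" "x \<le> t"
    then have "k x \<le> 0" using k_mono[of z x] z that by simp
    then have "(cos x)\<^sup>2 * k x \<le> 0" by (simp add: mult_nonneg_nonpos)
    then show "\<exists>y. (h has_real_derivative y) (at x) \<and> y \<le> 0" using h'[of x] by blast
  qed
  have "h (pi / 2) \<le> 0" by (simp add: h_def)
  moreover have "continuous_on {z..pi / 2} h" unfolding h_def by (intro continuous_intros)
  \<comment> \<open>At \<open>y\<close> the function \<open>h\<close> changes sign, so
    \<open>f\<close> rises up to \<open>y\<close> and falls afterwards.\<close>
  ultimately obtain y where y: "z \<le> y" "y \<le> pi / 2" "h y = 0"
    using IVT2'[of h "pi / 2" 0 z] h_up[OF z(1) order_refl] z(2) by auto
  have "0 \<le> f t"
  proof (cases "t \<le> y")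
    case True
    have "f 0 \<le> f t"
    proof (rule DERIV_nonneg_imp_nondecreasing[OF assms(1)])
      fix x assume x: "0 \<le> x" "x \<le> t"
      have "0 \<le> h x"
        using h_up[of x] h_down[of x y] x y True by (cases "x \<le> z") auto
      then show "\<exists>y. (f has_real_derivative y) (at x) \<and> 0 \<le> y" using f'[of x] by (intro exI[of _ "(cos x)\<^sup>2 * h x"]) simp
    qed
    then show ?thesis by (simp add: f_def)
  next
    case False
    have "f (pi / 2) \<le> f t"
    proof (rule DERIV_nonpos_imp_nonincreasing[OF assms(2)])
      fix x assume x: "t \<le> x" "x \<le> pi / 2"
      have "h x \<le> 0" using h_down[of y x] x y False by auto
      then have "(cos x)\<^sup>2 * h x \<le> 0" by (simp add: mult_nonneg_nonpos)
      then show "\<exists>y. (f has_real_derivative y) (at x) \<and> y \<le> 0" using f'[of x] by blast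
    qed
    then show ?thesis by (simp add: f_def power_divide)
  qed
  then show ?thesis by (simp add: f_def)
qed

lemma cap_trig_inequality:
  assumes "- (pi / 2) \<le> t" "t \<le> pi / 2"
  shows "4 * (t + sin t * cos t)\<^sup>2 \<le> pi\<^sup>2 * (1 - cos t ^ 6)"
proof (cases "0 \<le> t")
  case True
  then show ?thesis using cap_trig_inequality_nonneg assms by blast
next
  case False
  have "4 * (- t + sin (- t) * cos (- t))\<^sup>2 \<le> pi\<^sup>2 * (1 - cos (- t) ^ 6)"
    using False assms by (intro cap_trig_inequality_nonneg) auto
  moreover have "(- t - sin t * cos t)\<^sup>2 = (t + sin t * cos t)\<^sup>2" by (simp add: power2_eq_square algebra_simps)
  ultimately show ?thesis by simp
qed

text \<open>The area of a cap runs continuously from \<open>pi\<close> at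
  \<open>t = - (pi / 2)\<close> to 0 at \<open>t = pi / 2\<close>.\<close>

lemma obtain_cap_of_area:
  assumes "0 \<le> a" "a \<le> pi"
  obtains t where "- (pi / 2) \<le> t" "t \<le> pi / 2" "a = pi / 2 - t - sin t * cos t"
proof -
  have "\<exists>t. - (pi / 2) \<le> t \<and> t \<le> pi / 2 \<and> pi / 2 - t - sin t * cos t = a"
    by (rule IVT2') (use assms in \<open>auto intro!: continuous_intros\<close>)
  then show ?thesis using that by blast
qed

text \<open>The cap of the same area bounds the first moment. For its parameter \<open>t\<close>,
  \<open>4 * (a * (pi - a))\<close> equals
  \<open>pi\<^sup>2 - 4 * (t + sin t * cos t)\<^sup>2\<close>, and
  \<open>1 / a + 1 / (pi - a)\<close> is \<open>pi / (a * (pi - a))\<close>, so the trigonometric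
  inequality gives the bound.\<close>

lemma norm_first_moment_sq_le:
  fixes c :: "real^2"
  assumes A: "A \<in> sets lebesgue" "A \<subseteq> cball c 1"
  defines "a \<equiv> measure lebesgue A"
  assumes "0 < a" "a < pi"
  shows "(norm (LINT x:A|lebesgue. x - c))\<^sup>2 * (1 / a + 1 / (pi - a)) \<le> 16 / (9 * pi)"
proof -
  define m where "m = (LINT x:A|lebesgue. x - c)"
  obtain t where t: "- (pi / 2) \<le> t" "t \<le> pi / 2" "a = pi / 2 - t - sin t * cos t"
    using obtain_cap_of_area[of a] assms by auto
  have cos0: "0 \<le> cos t" using t by (intro cos_ge_zero) auto
  have m_le: "norm m \<le> 2 / 3 * cos t ^ 3"
  proof (cases "m = 0")
    case False
    \<comment> \<open>Testing in the direction of \<open>m\<close> itself recovers its norm.\<close>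
    define u where "u = (1 / norm m) *\<^sub>R m"
    have u: "norm u = 1" "u \<bullet> m = norm m"
      using False by (auto simp: u_def power2_norm_eq_inner[symmetric] power2_eq_square)
    have "u \<bullet> m = (LINT x:A|lebesgue. u \<bullet> (x - c))"
      unfolding m_def by (rule inner_first_moment[OF A])
    also have "\<dots> \<le> 2 / 3 * cos t ^ 3"
      using t by (intro first_moment_le_cap[OF u(1) _ _ A]) (auto simp: a_def)
    finally show ?thesis using u by simp
  qed (use cos0 in simp)
  have "(norm m)\<^sup>2 \<le> (2 / 3 * cos t ^ 3)\<^sup>2" using m_le by (intro power_mono) auto
  also have "\<dots> = 4 / 9 * cos t ^ 6" by (simp add: power_mult_distrib power_divide power_mult[symmetric])
  finally have 1: "(norm m)\<^sup>2 \<le> 4 / 9 * cos t ^ 6" .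
  have "pi\<^sup>2 * cos t ^ 6 \<le> pi\<^sup>2 - 4 * (t + sin t * cos t)\<^sup>2"
    using cap_trig_inequality[OF t(1,2)] by (simp add: algebra_simps)
  also have "\<dots> = 4 * (a * (pi - a))" unfolding t(3) by (simp add: power2_eq_square algebra_simps)
  finally have "4 / 9 * (pi\<^sup>2 * cos t ^ 6) \<le> 4 / 9 * (4 * (a * (pi - a)))" by (rule mult_left_mono) simp
  moreover have "pi\<^sup>2 * (norm m)\<^sup>2 \<le> 4 / 9 * (pi\<^sup>2 * cos t ^ 6)"
    using mult_left_mono[OF 1, of "pi\<^sup>2"] by (simp only: mult.left_commute) simp
  ultimately have 2: "pi\<^sup>2 * (norm m)\<^sup>2 \<le> 16 / 9 * (a * (pi - a))" by linarith
  have "(norm m)\<^sup>2 * (1 / a + 1 / (pi - a)) = pi\<^sup>2 * (norm m)\<^sup>2 / (pi * (a * (pi - a)))"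
    using \<open>0 < a\<close> \<open>a < pi\<close> by (simp add: field_simps power2_eq_square)
  also have "\<dots> \<le> 16 / 9 * (a * (pi - a)) / (pi * (a * (pi - a)))"
    using 2 \<open>0 < a\<close> \<open>a < pi\<close> by (intro divide_right_mono) auto
  also have "\<dots> = 16 / (9 * pi)"
    using \<open>0 < a\<close> \<open>a < pi\<close> by (simp add: divide_simps)
  finally show ?thesis by (simp add: m_def)
qed

text \<open>For a null set the formula survives because both integrals vanish and \<open>x / 0 = 0\<close>.\<close>

lemma moment_of_inertia_eq:
  fixes c :: "real^2"
  assumes A: "A \<in> sets lebesgue" "A \<subseteq> cball c 1"
  shows "moment_of_inertia A
    = (LINT x:A|lebesgue. (norm (x - c))\<^sup>2) - (norm (LINT x:A|lebesgue. x - c))\<^sup>2 / area A"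
proof (cases "area A = 0")
  case True
  then show ?thesis
    by (simp add: moment_of_inertia_def area_def
      set_integral_of_measure_zero[OF disk_subset_lmeasurable[OF A]])
next
  case False
  define a m where "a = area A" and "m = (LINT x:A|lebesgue. x - c)"
  have fm: "A \<in> lmeasurable" using disk_subset_lmeasurable[OF A] .
  have const: "(LINT x:A|lebesgue. k) = a *\<^sub>R k" for k :: "'b::euclidean_space"
    using set_integral_const_lmeasurable[OF fm] by (simp add: a_def area_def)
  have "(LINT x:A|lebesgue. x) = (LINT x:A|lebesgue. (x - c) + c)" by simp
  also have "\<dots> = m + a *\<^sub>R c"
    unfolding m_def const[symmetric]
    by (rule set_integral_add) (auto intro!: set_integrable_disk_subset[OF A] continuous_intros)
  finally have "centroid A = (1 / a) *\<^sub>R m + c"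
    using False by (simp add: centroid_def a_def scaleR_add_right)
  then have cen: "centroid A - c = (1 / a) *\<^sub>R m" by simp
  \<comment> \<open>Parallel axis theorem: \<open>w\<close> is the displacement of the centroid from
    \<open>c\<close>, and the squared distance is expanded about \<open>c\<close>.\<close>
  define w where "w = (1 / a) *\<^sub>R m"
  have wm: "(LINT x:A|lebesgue. w \<bullet> (x - c)) = w \<bullet> m"
    unfolding m_def by (rule inner_first_moment[OF A, symmetric])
  have "(norm (x - centroid A))\<^sup>2 = ((norm (x - c))\<^sup>2 - 2 * (w \<bullet> (x - c))) + (norm w)\<^sup>2" for x
  proof -
    have "x - centroid A = (x - c) - w" using cen by (simp add: w_def algebra_simps)
    then show ?thesis
      by (simp only: power2_norm_eq_inner) (simp add: inner_diff_left inner_diff_right inner_commute)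
  qed
  then have "moment_of_inertia A = (LINT x:A|lebesgue. ((norm (x - c))\<^sup>2 - 2 * (w \<bullet> (x - c))) + (norm w)\<^sup>2)"
    by (simp add: moment_of_inertia_def)
  also have "\<dots> = (LINT x:A|lebesgue. (norm (x - c))\<^sup>2 - 2 * (w \<bullet> (x - c))) + a *\<^sub>R (norm w)\<^sup>2"
    unfolding const[symmetric]
    by (rule set_integral_add) (auto intro!: set_integrable_disk_subset[OF A] continuous_intros)
  also have "(LINT x:A|lebesgue. (norm (x - c))\<^sup>2 - 2 * (w \<bullet> (x - c)))
      = (LINT x:A|lebesgue. (norm (x - c))\<^sup>2) - (LINT x:A|lebesgue. 2 * (w \<bullet> (x - c)))"
    by (rule set_integral_diff) (auto intro!: set_integrable_disk_subset[OF A] continuous_intros)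
  also have "(LINT x:A|lebesgue. 2 * (w \<bullet> (x - c))) = 2 * (w \<bullet> m)"
    using wm by simp
  also have "w \<bullet> m = (norm m)\<^sup>2 / a" by (simp add: w_def power2_norm_eq_inner)
  also have "(norm w)\<^sup>2 = (norm m)\<^sup>2 / a\<^sup>2" by (simp add: w_def power_divide)
  finally show ?thesis using False by (simp add: a_def m_def power2_eq_square)
qed

section \<open>Moments of the whole disk and of its two parts\<close>

lemma area_unit_disk: "measure lebesgue (cball c 1) = pi" for c :: "real^2"
  by (simp add: content_cball unit_ball_vol_2)

text \<open>For \<open>t = - (pi / 2)\<close> the cap is the whole disk and its bound is 0, so no
  directional moment is positive. In the direction of the moment itself this forces the moment to
  vanish.\<close>

lemma first_moment_disk: "(LINT x:cball c 1|lebesgue. x - c) = 0" for c :: "real^2"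
proof -
  define m where "m = (LINT x:cball c 1|lebesgue. x - c)"
  have "u \<bullet> m \<le> 0" if u: "norm u = 1" for u
  proof -
    have "u \<bullet> m = (LINT x:cball c 1|lebesgue. u \<bullet> (x - c))"
      unfolding m_def by (rule inner_first_moment) auto
    also have "\<dots> \<le> 2 / 3 * cos (- (pi / 2)) ^ 3"
      by (rule first_moment_le_cap[OF u]) (auto simp: area_unit_disk)
    finally show ?thesis by simp
  qed
  from this[of "(1 / norm m) *\<^sub>R m"] have "m = 0"
    by (cases "m = 0") (auto simp: power2_norm_eq_inner[symmetric] power2_eq_square)
  then show ?thesis by (simp add: m_def)
qed

lemma polar_moment_disk: "(LINT x:cball c 1|lebesgue. (norm (x - c))\<^sup>2) = pi / 2" for c :: "real^2"
proof -
  have "(norm y)\<^sup>2 = (axis 1 1 \<bullet> y)\<^sup>2 + (axis 2 1 \<bullet> y)\<^sup>2" for y :: "real^2"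
    unfolding power2_norm_eq_inner inner_axis' by (simp add: inner_vec_def sum_2 power2_eq_square)
  then have "(LINT x:cball c 1|lebesgue. (norm (x - c))\<^sup>2)
      = (LINT x:cball c 1|lebesgue. (axis 1 1 \<bullet> (x - c))\<^sup>2 + (axis 2 1 \<bullet> (x - c))\<^sup>2)" by simp
  also have "\<dots> = (LINT x:cball c 1|lebesgue. (axis 1 1 \<bullet> (x - c))\<^sup>2) + (LINT x:cball c 1|lebesgue. (axis 2 1 \<bullet> (x - c))\<^sup>2)"
    by (rule set_integral_add) (auto intro!: set_integrable_disk_subset continuous_intros)
  also have "\<dots> = pi / 4 + pi / 4"
    using second_moment_disk[of "axis 1 1" 0 c] second_moment_disk[of "axis 2 1" 0 c]
    by (simp only: norm_axis_1) simp
  finally show ?thesis by simp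
qed

text \<open>The disk has first moment 0 about \<open>c\<close>, so the parts have opposite first
  moments and the same square appears over both areas. Parts of area 0 are included, as
  \<open>1 / 0 = 0\<close>.\<close>

lemma moments_of_disk_partition:
  fixes c :: "real^2"
  assumes AB: "A \<union> B = cball c 1" "A \<inter> B = {}" "A \<in> sets lebesgue" "B \<in> sets lebesgue"
  shows "area A + area B = pi"
    and "moment_of_inertia A + moment_of_inertia B
      = pi / 2 - (norm (LINT x:A|lebesgue. x - c))\<^sup>2 * (1 / area A + 1 / area B)"
    and "(LINT x:B|lebesgue. x - c) = - (LINT x:A|lebesgue. x - c)"
proof -
  have sub: "A \<subseteq> cball c 1" "B \<subseteq> cball c 1" using AB(1) by auto
  note fm = disk_subset_lmeasurable[OF AB(3) sub(1)] disk_subset_lmeasurable[OF AB(4) sub(2)]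
  have "measure lebesgue (A \<union> B) = measure lebesgue A + measure lebesgue B"
    using fm AB(2) by (intro measure_Union) (auto simp: fmeasurable_def)
  then show "area A + area B = pi" by (simp add: area_def AB(1) area_unit_disk)
  have split: "(LINT x:A|lebesgue. f x) + (LINT x:B|lebesgue. f x) = (LINT x:cball c 1|lebesgue. f x)"
    if "continuous_on UNIV f" for f :: "real^2 \<Rightarrow> 'b::euclidean_space"
    unfolding AB(1)[symmetric] using AB sub continuous_on_subset[OF that]
    by (intro set_integral_Un[symmetric] set_integrable_disk_subset) auto
  have "(LINT x:A|lebesgue. x - c) + (LINT x:B|lebesgue. x - c) = 0"
    by (subst split) (auto intro!: continuous_intros simp: first_moment_disk)
  then show m: "(LINT x:B|lebesgue. x - c) = - (LINT x:A|lebesgue. x - c)"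
    by (simp add: eq_neg_iff_add_eq_0 add.commute)
  have "(LINT x:A|lebesgue. (norm (x - c))\<^sup>2) + (LINT x:B|lebesgue. (norm (x - c))\<^sup>2) = pi / 2"
    by (subst split) (auto intro!: continuous_intros simp: polar_moment_disk)
  then show "moment_of_inertia A + moment_of_inertia B
      = pi / 2 - (norm (LINT x:A|lebesgue. x - c))\<^sup>2 * (1 / area A + 1 / area B)"
    by (simp add: moment_of_inertia_eq[OF AB(3) sub(1)] moment_of_inertia_eq[OF AB(4) sub(2)] m algebra_simps)
qed

lemma moments_of_disk_partition_ge:
  fixes c :: "real^2"
  assumes AB: "A \<union> B = cball c 1" "A \<inter> B = {}" "A \<in> sets lebesgue" "B \<in> sets lebesgue"
  shows "pi / 2 - 16 / (9 * pi) \<le> moment_of_inertia A + moment_of_inertia B"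
proof -
  define m where "m = (LINT x:A|lebesgue. x - c)"
  have sub: "A \<subseteq> cball c 1" "B \<subseteq> cball c 1" using AB(1) by auto
  note moments = moments_of_disk_partition[OF AB]
  have nonneg: "0 \<le> area A" "0 \<le> area B" by (auto simp: area_def)
  note zero = set_integral_of_measure_zero[OF disk_subset_lmeasurable[OF AB(3) sub(1)]]
    set_integral_of_measure_zero[OF disk_subset_lmeasurable[OF AB(4) sub(2)]]
  have "(norm m)\<^sup>2 * (1 / area A + 1 / area B) \<le> 16 / (9 * pi)"
  proof (cases "area A = 0 \<or> area B = 0")
    case True
    then have "m = 0"
      using zero[where f = "\<lambda>x. x - c"] moments(3) by (auto simp: m_def area_def)
    then show ?thesis by simp
  next
    case False
    then have a: "0 < area A" "area A < pi" "area B = pi - area A"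
      using nonneg moments(1) by linarith+
    show ?thesis
      using norm_first_moment_sq_le[OF AB(3) sub(1)] a by (simp add: m_def area_def)
  qed
  then show ?thesis using moments(2) by (simp add: m_def)
qed

section \<open>Half-disks\<close>

definition closed_half_disk :: "real^2 \<Rightarrow> real^2 \<Rightarrow> (real^2) set" where
  "closed_half_disk c u = {x \<in> cball c 1. 0 \<le> u \<bullet> (x - c)}"

lemma closed_half_disk_eq: "closed_half_disk c u = cball c 1 \<inter> {x. u \<bullet> c \<le> u \<bullet> x}"
  by (auto simp: closed_half_disk_def inner_diff_right)

lemma convex_closed_half_disk: "convex (closed_half_disk c u)"
  unfolding closed_half_disk_eq by (intro convex_Int convex_halfspace_ge) auto

lemma compact_closed_half_disk: "compact (closed_half_disk c u)"
  unfolding closed_half_disk_eq by (intro compact_Int_closed closed_halfspace_ge) auto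

lemma interior_closed_half_disk:
  assumes "norm u = 1"
  shows "interior (closed_half_disk c u) = {x \<in> ball c 1. 0 < u \<bullet> (x - c)}"
proof -
  have "u \<noteq> 0" using assms by auto
  then show ?thesis
    unfolding closed_half_disk_eq by (auto simp: interior_Int interior_halfspace_ge inner_diff_right)
qed

lemma interior_closed_half_disk_nonempty:
  assumes "norm u = 1"
  shows "interior (closed_half_disk c u) \<noteq> {}"
proof -
  have "u \<bullet> u = 1" using assms by (simp add: norm_eq_1)
  then have "c + (1/2) *\<^sub>R u \<in> interior (closed_half_disk c u)"
    unfolding interior_closed_half_disk[OF assms] using assms by (simp add: dist_norm)
  then show ?thesis by blast
qed

text \<open>\<open>X\<close> differs from the closed half-disk only within the boundary of a convex
  set, which is null. How the boundary points are shared out affects neither the closure nor the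
  integrals.\<close>

lemma between_half_disks:
  fixes c u :: "real^2"
  assumes u: "norm u = 1" and X: "interior (closed_half_disk c u) \<subseteq> X" "X \<subseteq> closed_half_disk c u"
  shows "closure X = closed_half_disk c u" and "X \<in> lmeasurable"
    and "measure lebesgue X = pi / 2"
    and "(LINT x:X|lebesgue. u \<bullet> (x - c)) = 2 / 3"
proof -
  let ?H = "closed_half_disk c u"
  have cl: "closed ?H" using compact_closed_half_disk compact_imp_closed by blast
  have "closure (interior ?H) = ?H"
    using convex_closure_interior[OF convex_closed_half_disk interior_closed_half_disk_nonempty[OF u]] cl by simp
  then show "closure X = ?H"
    using closure_mono[OF X(1)] closure_minimal[OF X(2) cl] by auto
  have neg: "negligible (?H - interior ?H)"
    using negligible_convex_frontier[OF convex_closed_half_disk, of c u] cl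
    by (simp add: frontier_def)
  have H: "?H \<in> lmeasurable" using compact_closed_half_disk by (rule lmeasurable_compact)
  have neg': "negligible (?H - X)" by (rule negligible_subset[OF neg]) (use X in blast)
  have sd: "X = ?H - (?H - X)" using X by blast
  have "?H - (?H - X) \<in> lmeasurable"
    using H neg' by (intro fmeasurable_Diff) (auto simp: negligible_imp_sets)
  then show X_meas: "X \<in> lmeasurable" using sd by simp
  have H_cap: "?H = {x \<in> cball c 1. sin 0 \<le> u \<bullet> (x - c)}" by (simp add: closed_half_disk_def)
  have "(?H - X) \<union> (X - ?H) = ?H - X" using X by blast
  then have "measure lebesgue X = measure lebesgue ?H"
    using neg' H by (intro measure_negligible_symdiff) auto
  also have "\<dots> = pi / 2" unfolding H_cap using area_cap[OF u, of 0 c] by simp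
  finally show "measure lebesgue X = pi / 2" .
  have AE: "AE x in lebesgue. x \<notin> ?H - X"
    using neg' by (intro AE_not_in) (simp add: negligible_iff_null_sets)
  have "(LINT x:X|lebesgue. u \<bullet> (x - c)) = (LINT x:?H|lebesgue. u \<bullet> (x - c))"
  proof (rule set_integral_cong_set)
    have f: "continuous_on UNIV (\<lambda>x. u \<bullet> (x - c))" by (intro continuous_intros)
    have sub: "X \<subseteq> cball c 1" "?H \<subseteq> cball c 1" using X by (auto simp: closed_half_disk_def)
    have "set_integrable lebesgue X (\<lambda>x. u \<bullet> (x - c))" "set_integrable lebesgue ?H (\<lambda>x. u \<bullet> (x - c))"
      using X_meas H sub f by (auto intro!: set_integrable_disk_subset continuous_intros)
    then show "set_borel_measurable lebesgue X (\<lambda>x. u \<bullet> (x - c))" "set_borel_measurable lebesgue ?H (\<lambda>x. u \<bullet> (x - c))"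
      by (auto simp: set_integrable_def set_borel_measurable_def borel_measurable_integrable)
    show "AE x in lebesgue. (x \<in> ?H) = (x \<in> X)"
      using AE by (rule eventually_mono) (use X in blast)
  qed
  also have "\<dots> = 2 / 3" unfolding H_cap using first_moment_cap[OF u, of 0 c] by simp
  finally show "(LINT x:X|lebesgue. u \<bullet> (x - c)) = 2 / 3" .
qed

text \<open>A curve of speed 1 covers the boundary in time \<open>pi + 2\<close>: first the half
  circle, then the diameter.\<close>

lemma hausdorff1_half_disk_boundary_le:
  fixes c u :: "real^2"
  assumes u: "norm u = 1"
  shows "hausdorff1 (closed_half_disk c u - interior (closed_half_disk c u)) \<le> ennreal (pi + 2)"
proof -
  have "(u $ 1)\<^sup>2 + (u $ 2)\<^sup>2 = 1" using norm_vec2_sq[of u] u by simp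
  then obtain \<phi> where \<phi>: "u $ 1 = cos \<phi>" "u $ 2 = sin \<phi>" using sincos_total_2pi by metis
  have u_inner: "u \<bullet> y = cos \<phi> * y $ 1 + sin \<phi> * y $ 2" for y :: "real^2"
    by (simp add: inner_vec_def sum_2 \<phi>)
  define w where "w = circle_pt c (\<phi> + pi / 2) - c"
  have w12: "w $ 1 = - sin \<phi>" "w $ 2 = cos \<phi>"
    by (simp_all add: w_def cos_add sin_add)
  have nw: "norm w = 1"
    using circle_pt_in_sphere[of c "\<phi> + pi / 2"] by (simp add: w_def dist_norm norm_minus_commute del: circle_pt_in_sphere)
  \<comment> \<open>\<open>w\<close> is \<open>u\<close> after a quarter turn. On
    \<open>{0..pi}\<close> the curve follows the half circle from \<open>c - w\<close> to
    \<open>c + w\<close>, and on \<open>{pi..pi + 2}\<close> the diameter back to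
    \<open>c - w\<close>.\<close>
  define g where "g = (\<lambda>t. if t \<le> pi then circle_pt c (\<phi> - pi / 2 + t) else c + (1 + pi - t) *\<^sub>R w)"
  have g_pi: "g pi = c + w" by (simp add: g_def w_def add.commute)
  have g1: "dist (g s) (g t) \<le> t - s" if "s \<le> t" "t \<le> pi" for s t
  proof -
    have "dist (g s) (g t) = 2 * \<bar>sin ((s - t) / 2)\<bar>"
      using that by (simp add: g_def dist_circle_pt)
    also have "\<dots> \<le> 2 * \<bar>(s - t) / 2\<bar>" using abs_sin_x_le_abs_x[of "(s - t) / 2"] by simp
    finally show ?thesis using that by simp
  qed
  have g2: "dist (g s) (g t) \<le> t - s" if "pi \<le> s" "s \<le> t" for s t
  proof -
    have g_eq: "g r = c + (1 + pi - r) *\<^sub>R w" if "pi \<le> r" for r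
      using that g_pi by (cases "r = pi") (auto simp: g_def)
    have "g s - g t = (t - s) *\<^sub>R w"
      using that by (simp add: g_eq scaleR_left_diff_distrib[symmetric])
    then show ?thesis using that nw by (simp add: dist_norm)
  qed
  have lip: "dist (g s) (g t) \<le> t - s" if "s \<le> t" for s t
  proof -
    consider "t \<le> pi" | "pi \<le> s" | "s \<le> pi" "pi \<le> t" by linarith
    then show ?thesis
    proof cases
      case 3
      then have "dist (g s) (g pi) \<le> pi - s" "dist (g pi) (g t) \<le> t - pi" using g1 g2 by auto
      then show ?thesis using dist_triangle[of "g s" "g t" "g pi"] by simp
    qed (use g1 g2 that in auto)
  qed
  have "closed_half_disk c u - interior (closed_half_disk c u) \<subseteq> g ` {0..pi + 2}"
  proof
    fix x assume x: "x \<in> closed_half_disk c u - interior (closed_half_disk c u)"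
    then have D: "x \<in> cball c 1" "0 \<le> u \<bullet> (x - c)" by (auto simp: closed_half_disk_def)
    have "x \<notin> ball c 1 \<or> u \<bullet> (x - c) \<le> 0" using x by (auto simp: interior_closed_half_disk[OF u])
    then consider "x \<in> sphere c 1" | "u \<bullet> (x - c) = 0" using D by force
    then show "x \<in> g ` {0..pi + 2}"
    proof cases
      case 1
      then obtain t where t: "0 \<le> t" "t < 2 * pi" "x = circle_pt c (\<phi> - pi / 2 + t)" by (rule circle_pt_surj)
      \<comment> \<open>With the angle measured from \<open>c - w\<close>, the height over the
        diameter is \<open>sin t\<close>; a nonnegative height therefore keeps \<open>t\<close> in
        \<open>{0..pi}\<close>.\<close>
      have "u \<bullet> (x - c) = cos (\<phi> - (\<phi> - pi / 2 + t))"
        unfolding cos_diff u_inner by (simp add: t(3))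
      also have "\<dots> = sin t" by (simp add: sin_cos_eq)
      finally have "0 \<le> sin t" using D by simp
      then have "t \<le> pi" using sin_lt_zero[of t] t by force
      then show ?thesis using t by (intro image_eqI[of _ _ t]) (auto simp: g_def)
    next
      case 2
      define y where "y = x - c"
      define r where "r = y \<bullet> w"
      have orth: "cos \<phi> * y $ 1 + sin \<phi> * y $ 2 = 0" using 2 u_inner by (simp add: y_def)
      have r_eq: "r = cos \<phi> * y $ 2 - sin \<phi> * y $ 1" by (simp add: r_def inner_vec_def sum_2 w12)
      have one: "(sin \<phi>)\<^sup>2 + (cos \<phi>)\<^sup>2 = 1" by simp
      have "r * w $ 1 = y $ 1" "r * w $ 2 = y $ 2"
        unfolding w12 r_eq using orth one by algebra+
      then have y_eq: "y = r *\<^sub>R w" by (simp add: vec_eq_iff forall_2)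
      have "\<bar>r\<bar> = norm y" using nw by (simp add: y_eq)
      then have "\<bar>r\<bar> \<le> 1" using D by (simp add: y_def dist_norm norm_minus_commute)
      moreover have "g (1 + pi - r) = x"
      proof (cases "r = 1")
        case True
        then show ?thesis using g_pi y_eq by (simp add: y_def algebra_simps)
      next
        case False
        then have "\<not> 1 + pi - r \<le> pi" using \<open>\<bar>r\<bar> \<le> 1\<close> by auto
        then show ?thesis using y_eq by (simp add: g_def y_def algebra_simps)
      qed
      moreover have "1 + pi - r \<in> {0..pi + 2}" using \<open>\<bar>r\<bar> \<le> 1\<close> pi_gt_zero unfolding atLeastAtMost_iff by (intro conjI; linarith)
      ultimately show ?thesis by (metis imageI)
    qed
  qed
  then have "hausdorff1 (closed_half_disk c u - interior (closed_half_disk c u)) \<le> hausdorff1 (g ` {0..pi + 2})"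
    by (rule hausdorff1_mono)
  also have "\<dots> \<le> ennreal (pi + 2)"
    using lip by (intro hausdorff1_lipschitz_curve_le) auto
  finally show ?thesis .
qed

text \<open>The convex hull of \<open>A\<close> is itself squeezed between the open and the closed
  half-disk, so it has the same area as \<open>A\<close>.\<close>

lemma half_disk_properties:
  fixes c u :: "real^2"
  assumes u: "norm u = 1" and A: "interior (closed_half_disk c u) \<subseteq> A" "A \<subseteq> closed_half_disk c u"
  shows "A \<in> sets lebesgue" "closure A homeomorphic cball c 1" "perimeter A \<le> ennreal (pi + 2)"
    "area A = pi / 2" "area (convex hull A) = pi / 2"
proof -
  let ?H = "closed_half_disk c u"
  note facts = between_half_disks[OF u A]
  show "A \<in> sets lebesgue" using facts(2) by blast
  show "area A = pi / 2" using facts(3) by (simp add: area_def)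
  show "closure A homeomorphic cball c 1"
    unfolding facts(1) using interior_closed_half_disk_nonempty[OF u]
    by (intro homeomorphic_convex_compact convex_closed_half_disk compact_closed_half_disk) auto
  have "interior ?H \<subseteq> interior A" using A(1) by (simp add: interior_maximal)
  then have "frontier A \<subseteq> ?H - interior ?H" using facts(1) by (auto simp: frontier_def)
  then show "perimeter A \<le> ennreal (pi + 2)"
    unfolding perimeter_def using hausdorff1_half_disk_boundary_le[OF u] hausdorff1_mono order_trans by blast
  have "convex hull A \<subseteq> ?H" using A(2) convex_closed_half_disk by (rule hull_minimal)
  moreover have "interior ?H \<subseteq> convex hull A" using A(1) hull_subset by (rule order_trans)
  ultimately show "area (convex hull A) = pi / 2"
    using between_half_disks(3)[OF u] by (simp add: area_def)
qed

section \<open>The three inequalities and their equality case\<close>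

lemma area_ratio_le_one:
  assumes "A \<in> sets lebesgue" "A \<subseteq> cball c 1"
  shows "area A / area (convex hull A) \<le> 1"
proof -
  have "bounded A" using assms(2) bounded_cball bounded_subset by blast
  then have "convex hull A \<in> lmeasurable"
    by (intro measurable_convex) (auto simp: bounded_convex_hull)
  then have "area A \<le> area (convex hull A)"
    unfolding area_def using assms hull_subset[of A convex] by (intro measure_mono_fmeasurable)
  moreover have "0 \<le> area (convex hull A)" by (simp add: area_def)
  \<comment> \<open>A hull of area 0 makes the quotient 0 by the convention for division by
    zero.\<close>
  ultimately show ?thesis by (cases "area (convex hull A) = 0") (auto simp: divide_le_eq)
qed

theorem mainTheorem1:
  fixes c :: "real^2"
  shows "(\<forall>A B. disk_partition (cball c 1) A B \<longrightarrow>
            max (perimeter A) (perimeter B) \<ge> ennreal (pi + 2) \<and>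
            min (area A / area (convex hull A)) (area B / area (convex hull B)) \<le> 1 \<and>
            moment_of_inertia A + moment_of_inertia B \<ge> pi / 2 - 16 / (9 * pi)) \<and>
         (\<forall>A B. complementary_half_disks c A B \<longrightarrow>
            disk_partition (cball c 1) A B \<and>
            max (perimeter A) (perimeter B) = ennreal (pi + 2) \<and>
            min (area A / area (convex hull A)) (area B / area (convex hull B)) = 1 \<and>
            moment_of_inertia A + moment_of_inertia B = pi / 2 - 16 / (9 * pi))"
proof (intro conjI allI impI)
  fix A B assume part: "disk_partition (cball c 1) A B"
  then have AB: "A \<union> B = cball c 1" "A \<inter> B = {}" "A \<in> sets lebesgue" "B \<in> sets lebesgue"
    by (auto simp: disk_partition_def)
  show "max (perimeter A) (perimeter B) \<ge> ennreal (pi + 2)"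
    using part by (rule disk_partition_perimeter_ge)
  have "area A / area (convex hull A) \<le> 1"
    using AB by (intro area_ratio_le_one) auto
  then show "min (area A / area (convex hull A)) (area B / area (convex hull B)) \<le> 1" by simp
  show "moment_of_inertia A + moment_of_inertia B \<ge> pi / 2 - 16 / (9 * pi)"
    using AB by (rule moments_of_disk_partition_ge)
next
  fix A B assume "complementary_half_disks c A B"
  then obtain v where AB: "A \<union> B = cball c 1" "A \<inter> B = {}" and v: "v \<noteq> 0"
    "{x \<in> cball c 1. v \<bullet> (x - c) > 0} \<subseteq> A" "{x \<in> cball c 1. v \<bullet> (x - c) < 0} \<subseteq> B"
    by (auto simp: complementary_half_disks_def)
  \<comment> \<open>Normalising keeps all signs; \<open>A\<close> becomes a half-disk for
    \<open>u\<close> and \<open>B\<close> one for \<open>- u\<close>.\<close>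
  define u where "u = (1 / norm v) *\<^sub>R v"
  have u: "norm u = 1" "norm (- u) = 1" using v(1) by (auto simp: u_def)
  have sgn: "v \<bullet> y > 0 \<longleftrightarrow> u \<bullet> y > 0" "v \<bullet> y < 0 \<longleftrightarrow> u \<bullet> y < 0" for y
    using v(1) by (auto simp: u_def zero_less_divide_iff divide_less_0_iff)
  have pos: "x \<in> A" if "x \<in> cball c 1" "u \<bullet> (x - c) > 0" for x using v(2) that sgn by blast
  have neg: "x \<in> B" if "x \<in> cball c 1" "u \<bullet> (x - c) < 0" for x using v(3) that sgn by blast
  have A: "interior (closed_half_disk c u) \<subseteq> A" "A \<subseteq> closed_half_disk c u"
  proof -
    show "interior (closed_half_disk c u) \<subseteq> A"
      using pos by (auto simp: interior_closed_half_disk[OF u(1)])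
    show "A \<subseteq> closed_half_disk c u"
    proof
      fix x assume "x \<in> A"
      moreover from this have "x \<in> cball c 1" "x \<notin> B" using AB by auto
      ultimately show "x \<in> closed_half_disk c u"
        using neg[of x] unfolding closed_half_disk_def by (auto simp: not_less[symmetric])
    qed
  qed
  have B: "interior (closed_half_disk c (- u)) \<subseteq> B" "B \<subseteq> closed_half_disk c (- u)"
  proof -
    show "interior (closed_half_disk c (- u)) \<subseteq> B"
      using neg by (auto simp: interior_closed_half_disk[OF u(2)])
    show "B \<subseteq> closed_half_disk c (- u)"
    proof
      fix x assume "x \<in> B"
      moreover from this have "x \<in> cball c 1" "x \<notin> A" using AB by auto
      ultimately show "x \<in> closed_half_disk c (- u)"
        using pos[of x] unfolding closed_half_disk_def by (auto simp: not_less[symmetric])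
    qed
  qed
  note hA = half_disk_properties[OF u(1) A] and hB = half_disk_properties[OF u(2) B]
  show part: "disk_partition (cball c 1) A B"
    using AB hA hB by (simp add: disk_partition_def)
  show "max (perimeter A) (perimeter B) = ennreal (pi + 2)"
    using disk_partition_perimeter_ge[OF part] hA(3) hB(3) by (intro antisym) auto
  show "min (area A / area (convex hull A)) (area B / area (convex hull B)) = 1"
    unfolding hA(4,5) hB(4,5) by simp
  define m where "m = (LINT x:A|lebesgue. x - c)"
  note moments = moments_of_disk_partition[OF AB hA(1) hB(1)]
  \<comment> \<open>A lower bound for \<open>norm m\<close> bounds the sum of the moments from
    above; the general inequality supplies the other direction.\<close>
  have "2 / 3 = u \<bullet> m"
    unfolding m_def using between_half_disks(4)[OF u(1) A] AB(1)
    by (subst inner_first_moment[OF hA(1)]) auto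
  also have "\<dots> \<le> norm m" using norm_cauchy_schwarz[of u m] u(1) by simp
  finally have "(2 / 3)\<^sup>2 \<le> (norm m)\<^sup>2" by (rule power_mono) simp
  \<comment> \<open>Both areas are \<open>pi / 2\<close>, so \<open>1 / area A + 1 / area B\<close>
    is \<open>4 / pi\<close>.\<close>
  then have "(2 / 3)\<^sup>2 * (4 / pi) \<le> (norm m)\<^sup>2 * (4 / pi)" by (intro mult_right_mono) auto
  then have "moment_of_inertia A + moment_of_inertia B \<le> pi / 2 - 16 / (9 * pi)"
    unfolding moments(2) hA(4) hB(4) by (simp add: m_def power_divide field_simps)
  then show "moment_of_inertia A + moment_of_inertia B = pi / 2 - 16 / (9 * pi)"
    using moments_of_disk_partition_ge[OF AB hA(1) hB(1)] by simp
qed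

end
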